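(* The family of Garside elements $(\Delta_k)_{k\ge 1}$ is a suboperad of the braid operad, isomorphic to the associative operad (the operad with exactly one element in each arity $k\ge1$). Indeed, for all $m\ge 1$ and all positive integers $i_1,\dots,i_m$, $$\Delta_m\left[\Delta_{i_1},\dots,\Delta_{i_m}\right]=\Delta_{i_1+\cdots+i_m}\quad\text{in } B_{i_1+\cdots+i_m}.$$
   Context: $B_m$ is the braid group on $m$ strands, with generators $\sigma_1,\dots,\sigma_{m-1}$ and the relations $\sigma_i\sigma_j=\sigma_j\sigma_i$ ($|i-j|>1$), $\sigma_i\sigma_{i+1}\sigma_i=\sigma_{i+1}\sigma_i\sigma_{i+1}$. Diagrammatically, $\sigma_i$ is the braid in which the $i$-th strand passes over the $(i+1)$-th, and products are read from top to bottom. For $i<j\le m$ let $\delta_{i,j}:=\sigma_{j-1}\sigma_{j-2}\cdots\sigma_i$; the Garside element is $\Delta_m:=\delta_{1,m}\delta_{2,m}\cdots\delta_{m-1,m}\in B_m$, with $\Delta_1=1\in B_1$ (and $\Delta_2=\sigma_1$). The braid operad is the non-symmetric operad of sets with $B_k$ in arity $k\ge1$, unit $1\in B_1$, and composition $$B_m\times B_{i_1}\times\cdots\times B_{i_m}\to B_{i_1+\cdots+i_m},\qquad(\beta,\beta_1,\dots,\beta_m)\mapsto\beta[\beta_1,\dots,\beta_m]$$ given by cabling: the $k$-th strand of $\beta$ (counted at the top) is replaced by a cable of $i_k$ strands, and the strands inside the cable are braided according to $\beta_k$. Formally, $\beta[\beta_1,\dots,\beta_m]=(\beta_1\oplus\cdots\oplus\beta_m)\cdot\beta(i_1,\dots,i_m)$,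 where $\oplus$ is juxtaposition of braids side by side, and $\beta(i_1,\dots,i_m)$ is obtained from $\beta$ by replacing its $k$-th strand by $i_k$ parallel strands. The latter is determined by: (i) with $s=i_1+\cdots+i_{k-1}$, $p=i_k$, $q=i_{k+1}$, $\sigma_k(i_1,\dots,i_m)=\prod_{j=1}^{q}\left(\sigma_{s+p+j-1}\sigma_{s+p+j-2}\cdots\sigma_{s+j}\right)$ (factors in order of increasing $j$), i.e. the block of $p$ strands passes over the block of $q$ strands; and (ii) $(\beta\gamma)(i_1,\dots,i_m)=\beta(i_1,\dots,i_m)\,\gamma(i'_1,\dots,i'_m)$, where $i'_1,\dots,i'_m$ are the cable sizes in the order in which the cables arrive at the bottom of $\beta$. *)

theory Defs
  imports "HOL-Algebra.Group"
begin

section \<open>Braid groups\<close>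

text \<open>
  \<open>B\<^sub>m\<close> is the group presented by the Artin generators and relations: its elements are the classes
  of words in signed letters modulo the least congruence containing the cancellations and the
  braid relations. The letter \<open>(i, True)\<close> stands for \<open>\<sigma>\<^sub>i\<close> and \<open>(i, False)\<close> for its inverse, with
  \<open>1 \<le> i < m\<close>; the leftmost letter is the topmost crossing.
\<close>

type_synonym bword = "(nat \<times> bool) list"

definition bwords :: "nat \<Rightarrow> bword set" where
  "bwords m = lists ({1..<m} \<times> UNIV)"

inductive_set braid_rel :: "nat \<Rightarrow> (bword \<times> bword) set" for m :: nat where
  refl: "w \<in> bwords m \<Longrightarrow> (w, w) \<in> braid_rel m"
| sym: "(u, v) \<in> braid_rel m \<Longrightarrow> (v, u) \<in> braid_rel m"
| trans: "(u, v) \<in> braid_rel m \<Longrightarrow> (v, w) \<in> braid_rel m \<Longrightarrow> (u, w) \<in> braid_rel m"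
| cong: "(u, v) \<in> braid_rel m \<Longrightarrow> (u', v') \<in> braid_rel m \<Longrightarrow> (u @ u', v @ v') \<in> braid_rel m"
| cancel: "i \<in> {1..<m} \<Longrightarrow> ([(i, e), (i, \<not> e)], []) \<in> braid_rel m"
| far: "i \<in> {1..<m} \<Longrightarrow> j \<in> {1..<m} \<Longrightarrow> \<bar>int i - int j\<bar> > 1 \<Longrightarrow>
    ([(i, True), (j, True)], [(j, True), (i, True)]) \<in> braid_rel m"
| braid: "i \<in> {1..<m} \<Longrightarrow> i + 1 \<in> {1..<m} \<Longrightarrow>
    ([(i, True), (i + 1, True), (i, True)], [(i + 1, True), (i, True), (i + 1, True)]) \<in> braid_rel m"

type_synonym braid = "bword set"

abbreviation braid_class :: "nat \<Rightarrow> bword \<Rightarrow> braid" where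
  "braid_class m w \<equiv> braid_rel m `` {w}"

definition braid_group :: "nat \<Rightarrow> braid monoid" where
  "braid_group m =
    \<lparr>carrier = bwords m // braid_rel m,
     monoid.mult = (\<lambda>X Y. \<Union>u\<in>X. \<Union>v\<in>Y. braid_class m (u @ v)),
     one = braid_class m []\<rparr>"

definition inv_word :: "bword \<Rightarrow> bword" where
  "inv_word w = map (\<lambda>(i, e). (i, \<not> e)) (rev w)"

lemma braid_rel_bwords: "(u, v) \<in> braid_rel m \<Longrightarrow> u \<in> bwords m \<and> v \<in> bwords m"
  by (induction rule: braid_rel.induct) (auto simp: bwords_def)

lemma equiv_braid_rel: "equiv (bwords m) (braid_rel m)"
proof (rule equivI)
  show "braid_rel m \<subseteq> bwords m \<times> bwords m"
    using braid_rel_bwords by auto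
  show "refl_on (bwords m) (braid_rel m)"
    by (auto simp: refl_on_def intro: braid_rel.refl)
  show "sym (braid_rel m)"
    by (auto simp: sym_def intro: braid_rel.sym)
  show "trans (braid_rel m)"
    by (auto simp: trans_def intro: braid_rel.trans)
qed

lemma braid_mult_class:
  assumes "u \<in> bwords m" "v \<in> bwords m"
  shows "braid_class m u \<otimes>\<^bsub>braid_group m\<^esub> braid_class m v = braid_class m (u @ v)"
proof -
  have c: "braid_class m (u' @ v') = braid_class m (u @ v)"
    if "u' \<in> braid_class m u" "v' \<in> braid_class m v" for u' v'
    using equiv_class_eq[OF equiv_braid_rel braid_rel.cong[of u u' m v v']] that by simp
  have ne: "u \<in> braid_class m u" "v \<in> braid_class m v"
    using assms by (simp_all add: braid_rel.refl)
  have "(\<Union>u'\<in>braid_class m u. \<Union>v'\<in>braid_class m v. braid_class m (u' @ v')) =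
    (\<Union>u'\<in>braid_class m u. \<Union>v'\<in>braid_class m v. braid_class m (u @ v))"
    by (intro SUP_cong HOL.refl c)
  also have "\<dots> = braid_class m (u @ v)"
    using ne by blast
  finally show ?thesis
    by (simp add: braid_group_def)
qed

lemma inv_word_right: "w \<in> bwords m \<Longrightarrow> (w @ inv_word w, []) \<in> braid_rel m"
proof (induction w)
  case Nil
  then show ?case by (simp add: inv_word_def braid_rel.refl)
next
  case (Cons a w)
  obtain i e where a: "a = (i, e)" by (cases a)
  have i: "i \<in> {1..<m}" and w: "w \<in> bwords m"
    using Cons.prems by (auto simp: a bwords_def)
  have l: "[(i, b)] \<in> bwords m" for b
    using i by (auto simp: bwords_def)
  have "([(i, e)] @ ((w @ inv_word w) @ [(i, \<not> e)]), [(i, e)] @ ([] @ [(i, \<not> e)])) \<in> braid_rel m"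
    by (intro braid_rel.cong braid_rel.refl l Cons.IH w)
  then have "((a # w) @ inv_word (a # w), [(i, e), (i, \<not> e)]) \<in> braid_rel m"
    by (simp add: inv_word_def a)
  then show ?case
    using braid_rel.cancel[OF i] by (rule braid_rel.trans)
qed

lemma inv_word_inv_word [simp]: "inv_word (inv_word w) = w"
  by (simp add: inv_word_def rev_map comp_def case_prod_unfold)

lemma inv_word_bwords: "w \<in> bwords m \<Longrightarrow> inv_word w \<in> bwords m"
  by (fastforce simp: inv_word_def bwords_def in_lists_conv_set)

lemma group_braid_group: "group (braid_group m)"
proof (rule groupI)
  have app: "u @ v \<in> bwords m" if "u \<in> bwords m" "v \<in> bwords m" for u v
    using that by (auto simp: bwords_def)
  have nil: "[] \<in> bwords m" by (simp add: bwords_def)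
  have cls: "\<exists>w\<in>bwords m. x = braid_class m w" if "x \<in> carrier (braid_group m)" for x
    using that by (auto simp: braid_group_def quotient_def)
  have mem: "braid_class m w \<in> carrier (braid_group m)" if "w \<in> bwords m" for w
    using that by (auto simp: braid_group_def quotient_def)
  have one: "\<one>\<^bsub>braid_group m\<^esub> = braid_class m []" by (simp add: braid_group_def)
  show "\<one>\<^bsub>braid_group m\<^esub> \<in> carrier (braid_group m)"
    using mem[OF nil] one by simp
  fix x assume x: "x \<in> carrier (braid_group m)"
  then obtain u where u: "u \<in> bwords m" "x = braid_class m u" using cls by blast
  show "\<one>\<^bsub>braid_group m\<^esub> \<otimes>\<^bsub>braid_group m\<^esub> x = x"
    using braid_mult_class[OF nil u(1)] by (simp add: one u(2))
  have "(inv_word u @ u, []) \<in> braid_rel m"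
    using inv_word_right[OF inv_word_bwords[OF u(1)]] by simp
  then have "braid_class m (inv_word u @ u) = braid_class m []"
    by (rule equiv_class_eq[OF equiv_braid_rel])
  then show "\<exists>y\<in>carrier (braid_group m). y \<otimes>\<^bsub>braid_group m\<^esub> x = \<one>\<^bsub>braid_group m\<^esub>"
    using mem[OF inv_word_bwords[OF u(1)]] braid_mult_class[OF inv_word_bwords[OF u(1)] u(1)]
    by (auto simp: one u(2))
  fix y assume y: "y \<in> carrier (braid_group m)"
  then obtain v where v: "v \<in> bwords m" "y = braid_class m v" using cls by blast
  show "x \<otimes>\<^bsub>braid_group m\<^esub> y \<in> carrier (braid_group m)"
    using mem[OF app[OF u(1) v(1)]] by (simp add: u(2) v(2) braid_mult_class[OF u(1) v(1)])
  fix z assume z: "z \<in> carrier (braid_group m)"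
  then obtain w where w: "w \<in> bwords m" "z = braid_class m w" using cls by blast
  show "x \<otimes>\<^bsub>braid_group m\<^esub> y \<otimes>\<^bsub>braid_group m\<^esub> z = x \<otimes>\<^bsub>braid_group m\<^esub> (y \<otimes>\<^bsub>braid_group m\<^esub> z)"
    using u v w by (simp add: braid_mult_class app)
qed

section \<open>Garside elements\<close>

text \<open>\<open>\<delta>\<^bsub>i,j\<^esub> = \<sigma>\<^bsub>j-1\<^esub> \<sigma>\<^bsub>j-2\<^esub> \<dots> \<sigma>\<^sub>i\<close>\<close>

definition delta_word :: "nat \<Rightarrow> nat \<Rightarrow> bword" where
  "delta_word i j = map (\<lambda>k. (k, True)) (rev [i..<j])"

definition garside_word :: "nat \<Rightarrow> bword" where
  "garside_word m = concat (map (\<lambda>i. delta_word i m) [1..<m])"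

definition garside :: "nat \<Rightarrow> braid" where
  "garside m = braid_class m (garside_word m)"

section \<open>Cabling\<close>

text \<open>
  \<open>cross_word s p q\<close>: the \<open>p\<close> strands following the first \<open>s\<close> pass over the next \<open>q\<close>. The factor
  \<open>\<sigma>\<^bsub>s+p+j-1\<^esub> \<dots> \<sigma>\<^bsub>s+j\<^esub>\<close> is \<open>\<delta>\<^bsub>s+j,s+p+j\<^esub>\<close>.
\<close>

definition cross_word :: "nat \<Rightarrow> nat \<Rightarrow> nat \<Rightarrow> bword" where
  "cross_word s p q = concat (map (\<lambda>j. delta_word (s + j) (s + p + j)) [1..<q + 1])"

text \<open>
  Lists are indexed from 0 and strands from 1, so the size of the \<open>k\<close>-th cable is \<open>is ! (k - 1)\<close>.
  The cabling of \<open>\<sigma>\<^sub>k\<^sup>-\<^sup>1\<close> is the one forced by multiplicativity: from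
  \<open>(\<sigma>\<^sub>k\<^sup>-\<^sup>1 \<sigma>\<^sub>k)(is) = 1\<close> it is the inverse of \<open>\<sigma>\<^sub>k\<close> cabled with the \<open>k\<close>-th and \<open>(k+1)\<close>-st sizes
  exchanged.
\<close>

fun cable_letter :: "nat list \<Rightarrow> nat \<times> bool \<Rightarrow> bword" where
  "cable_letter is (k, True) = cross_word (sum_list (take (k - 1) is)) (is ! (k - 1)) (is ! k)"
| "cable_letter is (k, False) =
    inv_word (cross_word (sum_list (take (k - 1) is)) (is ! k) (is ! (k - 1)))"

definition swap_sizes :: "nat \<Rightarrow> nat list \<Rightarrow> nat list" where
  "swap_sizes k is = is[k - 1 := is ! k, k := is ! (k - 1)]"

fun cable_word :: "bword \<Rightarrow> nat list \<Rightarrow> bword" where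
  "cable_word [] is = []"
| "cable_word (a # w) is = cable_letter is a @ cable_word w (swap_sizes (fst a) is)"

text \<open>
  \<open>\<beta>(i\<^sub>1,\<dots>,i\<^sub>m)\<close> and \<open>\<beta>\<^sub>1 \<oplus> \<dots> \<oplus> \<beta>\<^sub>m\<close> are defined on classes by taking the union over all
  representatives; this union is a single class since the class of the result does not depend on
  the representatives.
\<close>

definition cable :: "braid \<Rightarrow> nat list \<Rightarrow> braid" where
  "cable \<beta> is = (\<Union>w\<in>\<beta>. braid_class (sum_list is) (cable_word w is))"

definition shift_word :: "nat \<Rightarrow> bword \<Rightarrow> bword" where
  "shift_word n w = map (\<lambda>(i, e). (i + n, e)) w"

fun juxt_word :: "nat list \<Rightarrow> bword list \<Rightarrow> bword" where
  "juxt_word (i # is) (w # ws) = w @ shift_word i (juxt_word is ws)"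
| "juxt_word _ _ = []"

definition juxt :: "nat list \<Rightarrow> braid list \<Rightarrow> braid" where
  "juxt is \<beta>s = (\<Union>ws\<in>listset \<beta>s. braid_class (sum_list is) (juxt_word is ws))"

definition braid_comp :: "nat list \<Rightarrow> braid \<Rightarrow> braid list \<Rightarrow> braid" where
  "braid_comp is \<beta> \<beta>s = juxt is \<beta>s \<otimes>\<^bsub>braid_group (sum_list is)\<^esub> cable \<beta> is"

section \<open>Non-symmetric operads of sets\<close>

text \<open>
  \<open>op_comp P [i\<^sub>1,\<dots>,i\<^sub>m]\<close> is the composition map from \<open>P(m) \<times> P(i\<^sub>1) \<times> \<dots> \<times> P(i\<^sub>m)\<close> to
  \<open>P(i\<^sub>1 + \<dots> + i\<^sub>m)\<close>. An operad with operations in arities \<open>\<ge> 1\<close> only is one whose set of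
  operations of arity 0 is empty.
\<close>

record 'a ns_operad =
  ops :: "nat \<Rightarrow> 'a set"
  op_unit :: 'a
  op_comp :: "nat list \<Rightarrow> 'a \<Rightarrow> 'a list \<Rightarrow> 'a"

definition op_args :: "(nat \<Rightarrow> 'a set) \<Rightarrow> nat list \<Rightarrow> 'a list \<Rightarrow> bool" where
  "op_args S is ys \<longleftrightarrow> list_all2 (\<lambda>i y. y \<in> S i) is ys"

locale ns_operad =
  fixes P :: "'a ns_operad" (structure)
  assumes unit_closed: "op_unit P \<in> ops P 1"
    and comp_closed:
      "x \<in> ops P (length is) \<Longrightarrow> op_args (ops P) is ys \<Longrightarrow> op_comp P is x ys \<in> ops P (sum_list is)"
    and unit_left: "x \<in> ops P n \<Longrightarrow> op_comp P [n] (op_unit P) [x] = x"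
    and unit_right: "x \<in> ops P n \<Longrightarrow> op_comp P (replicate n 1) x (replicate n (op_unit P)) = x"
    and assoc:
      "x \<in> ops P (length jss) \<Longrightarrow> op_args (ops P) (map length jss) ys \<Longrightarrow>
       list_all2 (op_args (ops P)) jss zss \<Longrightarrow>
       op_comp P (concat jss) (op_comp P (map length jss) x ys) (concat zss) =
       op_comp P (map sum_list jss) x
         (map (\<lambda>k. op_comp P (jss ! k) (ys ! k) (zss ! k)) [0..<length jss])"

definition suboperad :: "(nat \<Rightarrow> 'a set) \<Rightarrow> 'a ns_operad \<Rightarrow> bool" where
  "suboperad S P \<longleftrightarrow> ns_operad P \<and> (\<forall>n. S n \<subseteq> ops P n) \<and> op_unit P \<in> S 1 \<and>
    (\<forall>is x ys. x \<in> S (length is) \<and> op_args S is ys \<longrightarrow> op_comp P is x ys \<in> S (sum_list is))"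

definition operad_iso :: "'a ns_operad \<Rightarrow> 'b ns_operad \<Rightarrow> (nat \<Rightarrow> 'a \<Rightarrow> 'b) \<Rightarrow> bool" where
  "operad_iso P Q \<phi> \<longleftrightarrow> (\<forall>n. bij_betw (\<phi> n) (ops P n) (ops Q n)) \<and>
    \<phi> 1 (op_unit P) = op_unit Q \<and>
    (\<forall>is x ys. x \<in> ops P (length is) \<and> op_args (ops P) is ys \<longrightarrow>
      \<phi> (sum_list is) (op_comp P is x ys) = op_comp Q is (\<phi> (length is) x) (map2 \<phi> is ys))"

definition isomorphic_operads :: "'a ns_operad \<Rightarrow> 'b ns_operad \<Rightarrow> bool" where
  "isomorphic_operads P Q \<longleftrightarrow> ns_operad P \<and> ns_operad Q \<and> (\<exists>\<phi>. operad_iso P Q \<phi>)"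

definition assoc_operad :: "unit ns_operad" where
  "assoc_operad =
    \<lparr>ops = (\<lambda>n. if n = 0 then {} else {()}), op_unit = (), op_comp = (\<lambda>_ _ _. ())\<rparr>"

definition braid_operad :: "braid ns_operad" where
  "braid_operad =
    \<lparr>ops = (\<lambda>n. if n = 0 then {} else carrier (braid_group n)),
     op_unit = \<one>\<^bsub>braid_group 1\<^esub>,
     op_comp = braid_comp\<rparr>"

definition garside_family :: "nat \<Rightarrow> braid set" where
  "garside_family n = (if n = 0 then {} else {garside n})"

end

theory Submission
  imports Defs
begin

text \<open>
  Everything rests on three facts about the crossing \<open>X(s, p, q)\<close> of a cable of \<open>p\<close> strands over a
  cable of \<open>q\<close> strands, the first \<open>s\<close> strands staying outside (\<open>cross_word s p q\<close>).

  \<^item> A cable may be passed in two portions, on either side of the crossing: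
    \<open>X(s, p, q + r) = X(s, p, q) X(s + q, p, r)\<close> and
    \<open>X(s, p + q, r) = X(s + p, q, r) X(s, p, r)\<close> (\<open>cross_word_add_right\<close>, \<open>cross_word_add_left\<close>).
  \<^item> A braid inside the upper cable slides through the crossing and comes out shifted by \<open>q\<close>
    (\<open>word_slide_cross\<close>).
  \<^item> Braids supported on disjoint blocks of strands commute (\<open>disjoint_blocks_commute\<close>).

  That the braid operad is an operad follows from them. Cabling respects the cubic relation because
  both of its sides become the crossing of a cable under two others, preceded or followed by the
  crossing of these two, which slides through (\<open>cross_word_braid\<close>, \<open>cable_word_respects\<close>).
  Cabling a cabled braid is cabling with the sums of the sizes, by induction on the two cables of a
  single crossing (\<open>cable_cable_word\<close>). Juxtaposition is multiplicative, by the commutation of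
  disjoint blocks (\<open>juxt_word_mult\<close>), and cabling a juxtaposition gives the juxtaposition of the
  cabled braids. Associativity (\<open>comp_word_assoc\<close>) combines these, since
  \<open>\<beta>[\<beta>\<^sub>1, \<dots>, \<beta>\<^sub>m]\<close> is a juxtaposition followed by a cabling.

  For the Garside elements the basic identity is
  \<open>\<Delta>\<^bsub>n+q\<^esub> = (1\<^sub>n \<oplus> \<Delta>\<^sub>q) X(0, n, q) (1\<^sub>q \<oplus> \<Delta>\<^sub>n)\<close> (\<open>garside_word_add\<close>): a half twist of \<open>n + q\<close> strands
  half-twists the last \<open>q\<close> of them, carries the first \<open>n\<close> over these, and half-twists the first \<open>n\<close>.
  The formula \<open>\<Delta>\<^sub>m[\<Delta>\<^bsub>i\<^sub>1\<^esub>, \<dots>, \<Delta>\<^bsub>i\<^sub>m\<^esub>] = \<Delta>\<^bsub>i\<^sub>1+\<dots>+i\<^sub>m\<^esub>\<close> follows by induction on \<open>m\<close>: the first factor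
  \<open>\<delta>\<^bsub>1,m\<^esub>\<close> of \<open>\<Delta>\<^sub>m\<close> becomes the crossing of the first \<open>m - 1\<close> cables over the last one, the braids
  inside these cables slide through it, where they meet the cabled \<open>\<Delta>\<^bsub>m-1\<^esub>\<close> and form with it a single
  Garside element, and the basic identity applies (\<open>comp_word_garside\<close>). The family then has one
  element in each positive arity and is closed under composition, so it is a copy of the associative
  operad.

  Calculations take place on words modulo the braid relations, and descend to classes only when the
  operad axioms are verified.
\<close>

section \<open>Words up to the braid relations\<close>

text \<open>
  A binary predicate on words with the number of strands as its first argument, unlike membership
  of a pair in \<open>braid_rel m\<close>, lets calculations be chained by transitivity.
\<close>

definition braid_eq :: "nat \<Rightarrow> bword \<Rightarrow> bword \<Rightarrow> bool" where
  "braid_eq m u v \<longleftrightarrow> (u, v) \<in> braid_rel m"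

abbreviation (input) braid_eq_infix :: "bword \<Rightarrow> nat \<Rightarrow> bword \<Rightarrow> bool"
    ("(_ /\<approx>\<^bsub>_\<^esub> _)" [51, 0, 51] 50) where
  "u \<approx>\<^bsub>m\<^esub> v \<equiv> braid_eq m u v"

text \<open>
  The words that involve only the strands \<open>a + 1, \<dots>, b\<close>. With half-open blocks of strands, adjacent
  blocks \<open>(a, b]\<close> and \<open>(b, c]\<close> have generators whose indices differ by at least two, as \<open>\<sigma>\<^sub>b\<close> belongs to
  neither.
\<close>

definition block_words :: "nat \<Rightarrow> nat \<Rightarrow> bword set" where
  "block_words a b = lists ({a<..<b} \<times> UNIV)"

lemma bwords_block: "bwords m = block_words 0 m"
proof -
  have "{1..<m} = {0<..<m}" by auto
  then show ?thesis by (simp add: bwords_def block_words_def)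
qed

lemma block_words_Nil [simp]: "[] \<in> block_words a b"
  and block_words_Cons [simp]: "(i, e) # w \<in> block_words a b \<longleftrightarrow> a < i \<and> i < b \<and> w \<in> block_words a b"
  and block_words_append [simp]:
    "u @ v \<in> block_words a b \<longleftrightarrow> u \<in> block_words a b \<and> v \<in> block_words a b"
  by (auto simp: block_words_def)

lemma block_words_mono:
  "w \<in> block_words a b \<Longrightarrow> a' \<le> a \<Longrightarrow> b \<le> b' \<Longrightarrow> w \<in> block_words a' b'"
  by (fastforce simp: block_words_def in_lists_conv_set)

lemma block_words_bwords: "w \<in> block_words a b \<Longrightarrow> b \<le> m \<Longrightarrow> w \<in> bwords m"
  unfolding bwords_block by (rule block_words_mono) auto

lemma bwords_Nil [simp]: "[] \<in> bwords m"
  and bwords_Cons [simp]: "(i, e) # w \<in> bwords m \<longleftrightarrow> 1 \<le> i \<and> i < m \<and> w \<in> bwords m"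
  and bwords_append [simp]: "u @ v \<in> bwords m \<longleftrightarrow> u \<in> bwords m \<and> v \<in> bwords m"
  by (auto simp: bwords_def)

lemma bwords_mono: "w \<in> bwords m \<Longrightarrow> m \<le> n \<Longrightarrow> w \<in> bwords n"
  unfolding bwords_block by (rule block_words_mono) auto

lemma inv_word_append [simp]: "inv_word (u @ v) = inv_word v @ inv_word u"
  and inv_word_Nil [simp]: "inv_word [] = []"
  and inv_word_Cons [simp]: "inv_word ((i, e) # w) = inv_word w @ [(i, \<not> e)]"
  by (simp_all add: inv_word_def)

lemma shift_word_append [simp]: "shift_word n (u @ v) = shift_word n u @ shift_word n v"
  and shift_word_Nil [simp]: "shift_word n [] = []"
  and shift_word_Cons [simp]: "shift_word n ((i, e) # w) = (i + n, e) # shift_word n w"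
  by (simp_all add: shift_word_def)

lemma shift_word_shift_word [simp]: "shift_word m (shift_word n w) = shift_word (m + n) w"
  by (induction w) (auto simp: shift_word_def)

lemma shift_word_0 [simp]: "shift_word 0 w = w"
  by (induction w) (auto simp: shift_word_def)

lemma shift_word_inv_word: "shift_word n (inv_word w) = inv_word (shift_word n w)"
  by (induction w) auto

lemma block_words_shift: "w \<in> bwords m \<Longrightarrow> shift_word s w \<in> block_words s (s + m)"
  by (induction w) (auto simp: bwords_def)

lemma bwords_shift: "w \<in> bwords m \<Longrightarrow> s + m \<le> n \<Longrightarrow> shift_word s w \<in> bwords n"
  using block_words_shift block_words_bwords by blast

lemma braid_eq_refl: "w \<in> bwords m \<Longrightarrow> w \<approx>\<^bsub>m\<^esub> w"
  by (simp add: braid_eq_def braid_rel.refl)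

lemma braid_eq_sym: "u \<approx>\<^bsub>m\<^esub> v \<Longrightarrow> v \<approx>\<^bsub>m\<^esub> u"
  unfolding braid_eq_def by (rule braid_rel.sym)

lemma braid_eq_trans [trans]: "u \<approx>\<^bsub>m\<^esub> v \<Longrightarrow> v \<approx>\<^bsub>m\<^esub> w \<Longrightarrow> u \<approx>\<^bsub>m\<^esub> w"
  unfolding braid_eq_def by (rule braid_rel.trans)

lemma braid_eq_append: "u \<approx>\<^bsub>m\<^esub> v \<Longrightarrow> u' \<approx>\<^bsub>m\<^esub> v' \<Longrightarrow> u @ u' \<approx>\<^bsub>m\<^esub> v @ v'"
  unfolding braid_eq_def by (rule braid_rel.cong)

lemma braid_eq_bwords: "u \<approx>\<^bsub>m\<^esub> v \<Longrightarrow> u \<in> bwords m" "u \<approx>\<^bsub>m\<^esub> v \<Longrightarrow> v \<in> bwords m"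
  using braid_rel_bwords by (auto simp: braid_eq_def)

lemma braid_eq_within:
  assumes "u \<approx>\<^bsub>m\<^esub> v" "x \<in> bwords m" "y \<in> bwords m"
  shows "x @ u @ y \<approx>\<^bsub>m\<^esub> x @ v @ y"
  by (intro braid_eq_append braid_eq_refl assms)

lemma braid_eq_shift:
  assumes "u \<approx>\<^bsub>m\<^esub> v" "s + m \<le> n"
  shows "shift_word s u \<approx>\<^bsub>n\<^esub> shift_word s v"
  using assms(1) unfolding braid_eq_def
proof (induction rule: braid_rel.induct)
  case (refl w)
  then show ?case using bwords_shift assms(2) by (intro braid_rel.refl)
next
  case (sym u v)
  then show ?case by (blast intro: braid_rel.sym)
next
  case (trans u v w)
  then show ?case by (blast intro: braid_rel.trans)
next
  case (cong u v u' v')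
  then show ?case by (simp add: braid_rel.cong)
next
  case (cancel i e)
  then show ?case using braid_rel.cancel[of "i + s" n e] assms(2) by simp
next
  case (far i j)
  then show ?case using braid_rel.far[of "i + s" n "j + s"] assms(2) by simp
next
  case (braid i)
  then show ?case using braid_rel.braid[of "i + s" n] assms(2) by simp
qed

lemma braid_eq_mono: "u \<approx>\<^bsub>m\<^esub> v \<Longrightarrow> m \<le> n \<Longrightarrow> u \<approx>\<^bsub>n\<^esub> v"
  using braid_eq_shift[of m u v 0 n] by simp

lemma braid_eq_inv_right: "w \<in> bwords m \<Longrightarrow> w @ inv_word w \<approx>\<^bsub>m\<^esub> []"
  using inv_word_right by (simp add: braid_eq_def)

lemma braid_eq_inv_left: "w \<in> bwords m \<Longrightarrow> inv_word w @ w \<approx>\<^bsub>m\<^esub> []"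
  using inv_word_right[OF inv_word_bwords] by (simp add: braid_eq_def)

text \<open>
  The relation \<open>u w = w v\<close> says that \<open>v\<close> is the conjugate of \<open>u\<close> by \<open>w\<close>, hence passes to inverses. This
  extends every sliding rule from positive to signed letters.
\<close>

lemma braid_eq_conjugate_inv:
  assumes "u @ w \<approx>\<^bsub>m\<^esub> w @ v"
  shows "inv_word u @ w \<approx>\<^bsub>m\<^esub> w @ inv_word v"
proof -
  have [simp]: "u \<in> bwords m" "v \<in> bwords m" "w \<in> bwords m"
    using braid_eq_bwords[OF assms] by auto
  note [simp] = inv_word_bwords
  \<comment> \<open>Insert \<open>v v\<^sup>-\<^sup>1\<close>, exchange \<open>w v\<close> for \<open>u w\<close>, and cancel \<open>u\<^sup>-\<^sup>1 u\<close>.\<close>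
  have "inv_word u @ w @ v @ inv_word v \<approx>\<^bsub>m\<^esub> inv_word u @ w"
    using braid_eq_within[OF braid_eq_inv_right[of v m], of "inv_word u @ w" "[]"] by simp
  from braid_eq_sym[OF this]
  have "inv_word u @ w \<approx>\<^bsub>m\<^esub> inv_word u @ (w @ v) @ inv_word v" by simp
  also have "\<dots> \<approx>\<^bsub>m\<^esub> inv_word u @ (u @ w) @ inv_word v"
    by (rule braid_eq_within[OF braid_eq_sym[OF assms]]) simp_all
  also have "\<dots> \<approx>\<^bsub>m\<^esub> w @ inv_word v"
    using braid_eq_within[OF braid_eq_inv_left[of u m], of "[]" "w @ inv_word v"] by simp
  finally show ?thesis .
qed

lemma braid_eq_slide_step:
  assumes "u @ w \<approx>\<^bsub>m\<^esub> w @ u'" "v @ w \<approx>\<^bsub>m\<^esub> w @ v'"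
  shows "(u @ v) @ w \<approx>\<^bsub>m\<^esub> w @ (u' @ v')"
proof -
  have [simp]: "u \<in> bwords m" "v' \<in> bwords m"
    using braid_eq_bwords[OF assms(1)] braid_eq_bwords[OF assms(2)] by auto
  have "(u @ v) @ w \<approx>\<^bsub>m\<^esub> (u @ w) @ v'"
    using braid_eq_within[OF assms(2), of u "[]"] by simp
  also have "\<dots> \<approx>\<^bsub>m\<^esub> w @ (u' @ v')"
    using braid_eq_within[OF assms(1), of "[]" v'] by simp
  finally show ?thesis .
qed

text \<open>
  Since \<open>w\<close> acts by conjugation, a rule for sliding positive generators through \<open>w\<close> determines how
  all words slide. The case \<open>q = 0\<close> is commutation with \<open>w\<close>.
\<close>

lemma braid_eq_slide_shift:
  assumes "w \<in> bwords m" and "u \<in> block_words a b"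
    and letter: "\<And>i. a < i \<Longrightarrow> i < b \<Longrightarrow> [(i, True)] @ w \<approx>\<^bsub>m\<^esub> w @ [(i + q, True)]"
  shows "u @ w \<approx>\<^bsub>m\<^esub> w @ shift_word q u"
  using assms(2)
proof (induction u)
  case Nil
  then show ?case using assms(1) by (simp add: braid_eq_refl)
next
  case (Cons x u)
  obtain i e where x: "x = (i, e)" by (cases x)
  with Cons.prems have i: "a < i" "i < b" and u: "u \<in> block_words a b" by auto
  have "[(i, e)] @ w \<approx>\<^bsub>m\<^esub> w @ [(i + q, e)]"
    using letter[OF i] braid_eq_conjugate_inv[OF letter[OF i]] by (cases e) simp_all
  from braid_eq_slide_step[OF this Cons.IH[OF u]] show ?case by (simp add: x)
qed

text \<open>
  Far commutativity of generators, extended first to the word \<open>v\<close> sliding through one letter, then to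
  \<open>u\<close> sliding through \<open>v\<close>.
\<close>

lemma disjoint_blocks_commute:
  assumes "u \<in> block_words a b" "v \<in> block_words c d" "b \<le> c" "b \<le> m" "d \<le> m"
  shows "u @ v \<approx>\<^bsub>m\<^esub> v @ u"
proof -
  have v: "v \<in> bwords m" using assms block_words_bwords by blast
  have "[(i, True)] @ v \<approx>\<^bsub>m\<^esub> v @ [(i + 0, True)]" if i: "a < i" "i < b" for i
  proof -
    have iw: "[(i, True)] \<in> bwords m" using i assms by simp
    have "[(j, True)] @ [(i, True)] \<approx>\<^bsub>m\<^esub> [(i, True)] @ [(j + 0, True)]" if "c < j" "j < d" for j
      using braid_rel.far[of j m i] i that assms by (simp add: braid_eq_def)
    from braid_eq_slide_shift[OF iw assms(2) this]
    have "v @ [(i, True)] \<approx>\<^bsub>m\<^esub> [(i, True)] @ v" by simp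
    from braid_eq_sym[OF this] show ?thesis by simp
  qed
  from braid_eq_slide_shift[OF v assms(1) this] show ?thesis by simp
qed

section \<open>Crossings of cables\<close>

lemma delta_word_block: "s < i \<Longrightarrow> delta_word i t \<in> block_words s t"
  by (auto simp: delta_word_def block_words_def)

lemma delta_word_bwords [simp]: "0 < i \<Longrightarrow> j \<le> m \<Longrightarrow> delta_word i j \<in> bwords m"
  by (auto simp: delta_word_def bwords_def)

lemma delta_word_split: "i \<le> j \<Longrightarrow> j \<le> k \<Longrightarrow> delta_word i k = delta_word j k @ delta_word i j"
proof -
  assume "i \<le> j" "j \<le> k"
  then have "[i..<k] = [i..<j] @ [j..<k]"
    using upt_add_eq_append[of i j "k - j"] by simp
  then show ?thesis by (simp add: delta_word_def)
qed

lemma delta_word_empty [simp]: "delta_word i i = []"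
  and delta_word_single [simp]: "delta_word i (Suc i) = [(i, True)]"
  by (simp_all add: delta_word_def)

lemma shift_delta_word: "shift_word s (delta_word i j) = delta_word (s + i) (s + j)"
proof -
  have *: "map (\<lambda>k. k + s) [i..<j] = [s + i..<s + j]"
    by (induction j) (auto simp: add.commute)
  then show ?thesis
    by (simp add: shift_word_def delta_word_def rev_map comp_def flip: *)
qed

lemma cross_word_0_right [simp]: "cross_word s p 0 = []"
  by (simp add: cross_word_def)

lemma cross_word_Suc:
  "cross_word s p (Suc q) = cross_word s p q @ delta_word (s + Suc q) (s + p + Suc q)"
  by (simp add: cross_word_def)

lemma cross_word_1: "cross_word s p (Suc 0) = delta_word (Suc s) (Suc (s + p))"
  by (simp add: cross_word_def)

lemma cross_word_0_left [simp]: "cross_word s 0 q = []"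
  by (induction q) (simp_all add: cross_word_Suc)

lemma cross_word_block: "cross_word s p q \<in> block_words s (s + p + q)"
proof (induction q)
  case (Suc q)
  have "cross_word s p q \<in> block_words s (s + p + Suc q)"
    using Suc by (rule block_words_mono) auto
  then show ?case by (simp add: cross_word_Suc delta_word_block)
qed simp

lemma cross_word_bwords [simp]: "s + p + q \<le> m \<Longrightarrow> cross_word s p q \<in> bwords m"
  using cross_word_block block_words_bwords by blast

lemma shift_cross_word: "shift_word n (cross_word s p q) = cross_word (n + s) p q"
  by (induction q) (simp_all add: cross_word_Suc shift_delta_word add.assoc)

lemma cross_word_add_right: "cross_word s p (q + r) = cross_word s p q @ cross_word (s + q) p r"
  by (induction r) (simp_all add: cross_word_Suc ac_simps)

text \<open>
  A cable of \<open>p + q\<close> strands passing over another can be pushed across in two portions, the nearer \<open>q\<close>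
  strands first. For each further strand below, \<open>\<delta>\<close> factors into the part crossed by the \<open>q\<close> strands
  and the part crossed by the \<open>p\<close> strands; the former is disjoint from the crossings that the \<open>p\<close>
  strands have made so far, and commutes past them.
\<close>

lemma cross_word_add_left:
  assumes "s + p + q + r \<le> m"
  shows "cross_word s (p + q) r \<approx>\<^bsub>m\<^esub> cross_word (s + p) q r @ cross_word s p r"
  using assms
proof (induction r)
  case 0
  then show ?case by (simp add: braid_eq_refl)
next
  case (Suc r)
  let ?d = "delta_word (s + p + Suc r) (s + p + q + Suc r)"
  let ?e = "delta_word (s + Suc r) (s + p + Suc r)"
  have dB: "?d \<in> block_words (s + p + r) m"
    using delta_word_block[of "s + p + r" "s + p + Suc r"]
    by (rule block_words_mono) (use Suc.prems in auto)
  have comm: "cross_word s p r @ ?d \<approx>\<^bsub>m\<^esub> ?d @ cross_word s p r"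
    by (rule disjoint_blocks_commute[OF cross_word_block dB]) (use Suc.prems in auto)
  have "cross_word s (p + q) (Suc r) = cross_word s (p + q) r @ ?d @ ?e"
    using delta_word_split[of "s + Suc r" "s + p + Suc r" "s + p + q + Suc r"]
    by (simp add: cross_word_Suc add.assoc)
  also have "\<dots> \<approx>\<^bsub>m\<^esub> (cross_word (s + p) q r @ cross_word s p r) @ ?d @ ?e"
    by (intro braid_eq_append Suc.IH braid_eq_refl) (use Suc.prems in auto)
  also have "\<dots> \<approx>\<^bsub>m\<^esub> cross_word (s + p) q r @ (?d @ cross_word s p r) @ ?e"
    using braid_eq_within[OF comm, of "cross_word (s + p) q r" ?e] Suc.prems by simp
  finally show ?case by (simp add: cross_word_Suc)
qed

text \<open>
  A crossing of two strands is carried over the single strand that \<open>\<delta>\<close> moves to the left. Of the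
  letters of \<open>\<delta>\<close> only \<open>\<sigma>\<^bsub>i+1\<^esub> \<sigma>\<^sub>i\<close> fail to commute with what passes them, and there the cubic relation
  turns \<open>\<sigma>\<^sub>i \<sigma>\<^bsub>i+1\<^esub> \<sigma>\<^sub>i\<close> into \<open>\<sigma>\<^bsub>i+1\<^esub> \<sigma>\<^sub>i \<sigma>\<^bsub>i+1\<^esub>\<close>.
\<close>

lemma sigma_slide_delta:
  assumes "s < i" "i < t" "t < m"
  shows "[(i, True)] @ delta_word (Suc s) (Suc t) \<approx>\<^bsub>m\<^esub> delta_word (Suc s) (Suc t) @ [(i + 1, True)]"
proof -
  let ?a = "delta_word (i + 2) (Suc t)" and ?b = "delta_word (Suc s) i"
  \<comment> \<open>\<open>\<sigma>\<^sub>i\<close> commutes with the letters of \<open>?a\<close>, and \<open>\<sigma>\<^bsub>i+1\<^esub>\<close> with those of \<open>?b\<close>.\<close>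
  have d: "delta_word (Suc s) (Suc t) = ?a @ [(i + 1, True), (i, True)] @ ?b"
    using assms delta_word_split[of "Suc s" "i + 2" "Suc t"] delta_word_split[of i "i + 1" "i + 2"]
      delta_word_split[of "Suc s" i "i + 2"] by simp
  have aB: "?a \<in> block_words (i + 1) (Suc t)" by (rule delta_word_block) simp
  have bB: "?b \<in> block_words s i" by (rule delta_word_block) simp
  have c1: "[(i, True)] @ ?a \<approx>\<^bsub>m\<^esub> ?a @ [(i, True)]"
    by (rule disjoint_blocks_commute[of _ s "i + 1" _ "i + 1" "Suc t"]) (use aB assms in auto)
  have c2: "?b @ [(i + 1, True)] \<approx>\<^bsub>m\<^esub> [(i + 1, True)] @ ?b"
    by (rule disjoint_blocks_commute[of _ s i _ i "i + 2"]) (use bB assms in auto)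
  have br: "[(i, True), (i + 1, True), (i, True)] \<approx>\<^bsub>m\<^esub> [(i + 1, True), (i, True), (i + 1, True)]"
    unfolding braid_eq_def by (rule braid_rel.braid) (use assms in auto)
  have "[(i, True)] @ delta_word (Suc s) (Suc t)
      \<approx>\<^bsub>m\<^esub> ?a @ [(i, True), (i + 1, True), (i, True)] @ ?b"
    using braid_eq_within[OF c1, of "[]" "[(i + 1, True), (i, True)] @ ?b"] assms by (simp add: d)
  also have "\<dots> \<approx>\<^bsub>m\<^esub> ?a @ [(i + 1, True), (i, True), (i + 1, True)] @ ?b"
    by (rule braid_eq_within[OF br]) (use assms in simp_all)
  also have "\<dots> \<approx>\<^bsub>m\<^esub> delta_word (Suc s) (Suc t) @ [(i + 1, True)]"
    using braid_eq_within[OF braid_eq_sym[OF c2], of "?a @ [(i + 1, True), (i, True)]" "[]"] assms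
    by (simp add: d)
  finally show ?thesis .
qed

lemma sigma_slide_cross:
  assumes "s < i" "i < s + p" "s + p + q \<le> m"
  shows "[(i, True)] @ cross_word s p q \<approx>\<^bsub>m\<^esub> cross_word s p q @ [(i + q, True)]"
  using assms(3)
proof (induction q)
  case 0
  then show ?case using assms by (simp add: braid_eq_refl)
next
  case (Suc q)
  let ?d = "delta_word (s + Suc q) (s + p + Suc q)"
  have IH: "[(i, True)] @ cross_word s p q \<approx>\<^bsub>m\<^esub> cross_word s p q @ [(i + q, True)]"
    using Suc by simp
  have d: "[(i + q, True)] @ ?d \<approx>\<^bsub>m\<^esub> ?d @ [(i + Suc q, True)]"
    using sigma_slide_delta[of "s + q" "i + q" "s + p + q" m] assms Suc.prems by simp
  have "[(i, True)] @ cross_word s p (Suc q) \<approx>\<^bsub>m\<^esub> cross_word s p q @ [(i + q, True)] @ ?d"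
    using braid_eq_within[OF IH, of "[]" ?d] Suc.prems by (simp add: cross_word_Suc)
  also have "\<dots> \<approx>\<^bsub>m\<^esub> cross_word s p (Suc q) @ [(i + Suc q, True)]"
    using braid_eq_within[OF d, of "cross_word s p q" "[]"] Suc.prems
    by (simp add: cross_word_Suc)
  finally show ?case .
qed

lemma word_slide_cross:
  assumes "u \<in> block_words s (s + p)" "s + p + q \<le> m"
  shows "u @ cross_word s p q \<approx>\<^bsub>m\<^esub> cross_word s p q @ shift_word q u"
  using cross_word_bwords[OF assms(2)] assms(1) sigma_slide_cross[OF _ _ assms(2)]
  by (rule braid_eq_slide_shift)

text \<open>
  The cubic relation for cables. On either side the two portions of a cable of \<open>p + q\<close> strands
  passing over \<open>r\<close> strands can be merged; what remains is that the crossing of the portions may happen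
  before or after, which is \<open>word_slide_cross\<close>.
\<close>

lemma cross_word_braid:
  assumes "s + p + q + r \<le> m"
  shows "cross_word s p q @ cross_word (s + q) p r @ cross_word s q r
    \<approx>\<^bsub>m\<^esub> cross_word (s + p) q r @ cross_word s p r @ cross_word (s + r) p q"
proof -
  have "cross_word s p q @ cross_word (s + q) p r @ cross_word s q r
      \<approx>\<^bsub>m\<^esub> cross_word s p q @ cross_word s (p + q) r"
    using braid_eq_within[OF braid_eq_sym[OF cross_word_add_left[of s q p r m]],
        of "cross_word s p q" "[]"] assms by (simp add: add.commute add.left_commute)
  also have "\<dots> \<approx>\<^bsub>m\<^esub> cross_word s (p + q) r @ cross_word (s + r) p q"
    using word_slide_cross[of "cross_word s p q" s "p + q" r m] cross_word_block[of s p q] assms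
    by (simp add: shift_cross_word add.assoc add.commute[of r s])
  also have "\<dots> \<approx>\<^bsub>m\<^esub> cross_word (s + p) q r @ cross_word s p r @ cross_word (s + r) p q"
    using braid_eq_within[OF cross_word_add_left[OF assms], of "[]" "cross_word (s + r) p q"]
      assms by simp
  finally show ?thesis .
qed

section \<open>Permutation of the cables along a braid\<close>

text \<open>
  The polymorphic version of \<open>swap_sizes\<close>: when a braid is cabled twice, whole lists of sizes are
  permuted along with their lengths and sums.
\<close>

definition swap_at :: "nat \<Rightarrow> 'a list \<Rightarrow> 'a list" where
  "swap_at k xs = xs[k - 1 := xs ! k, k := xs ! (k - 1)]"

fun permute :: "bword \<Rightarrow> 'a list \<Rightarrow> 'a list" where
  "permute [] xs = xs"
| "permute (a # w) xs = permute w (swap_at (fst a) xs)"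

lemma swap_sizes_swap_at [simp]: "swap_sizes = swap_at"
  by (simp add: fun_eq_iff swap_sizes_def swap_at_def)

lemma swap_at_split: "swap_at (Suc (length us)) (us @ a # b # vs) = us @ b # a # vs"
  by (simp add: swap_at_def nth_append list_update_append)

lemma cable_letter_split:
  "cable_letter (us @ a # b # vs) (Suc (length us), True) = cross_word (sum_list us) a b"
  "cable_letter (us @ a # b # vs) (Suc (length us), False) = inv_word (cross_word (sum_list us) b a)"
  by (simp_all add: nth_append)

text \<open>
  Exhibiting the two cables that meet at a crossing turns the indexed descriptions of \<open>swap_at\<close> and
  \<open>cable_letter\<close> into equations on lists.
\<close>

lemma split_at_crossing:
  assumes "0 < k" "k < length xs"
  obtains us a b vs where "xs = us @ a # b # vs" "k = Suc (length us)"
proof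
  show "k = Suc (length (take (k - 1) xs))" using assms by simp
  have "xs = take (k - 1) xs @ xs ! (k - 1) # drop k xs"
    using id_take_nth_drop[of "k - 1" xs] assms by simp
  moreover have "drop k xs = xs ! k # drop (Suc k) xs"
    using assms by (simp add: Cons_nth_drop_Suc)
  ultimately show "xs = take (k - 1) xs @ xs ! (k - 1) # xs ! k # drop (Suc k) xs" by simp
qed

lemma length_permute [simp]: "length (permute w xs) = length xs"
  by (induction w arbitrary: xs) (simp_all add: swap_at_def)

lemma sum_list_permute:
  fixes "is" :: "nat list"
  shows "w \<in> bwords (length is) \<Longrightarrow> sum_list (permute w is) = sum_list is"
proof (induction w arbitrary: "is")
  case (Cons x w)
  obtain k e where x: "x = (k, e)" by (cases x)
  with Cons.prems have k: "0 < k" "k < length is" and w: "w \<in> bwords (length is)" by auto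
  obtain us a b vs where s: "is = us @ a # b # vs" "k = Suc (length us)"
    by (rule split_at_crossing[OF k])
  show ?case using w Cons.IH[of "us @ b # a # vs"] by (simp add: s x swap_at_split)
qed simp

lemma permute_append: "permute (u @ v) xs = permute v (permute u xs)"
  by (induction u arbitrary: xs) simp_all

lemma cable_word_append: "cable_word (u @ v) is = cable_word u is @ cable_word v (permute u is)"
  by (induction u arbitrary: "is") simp_all

lemma cable_word_bwords: "w \<in> bwords (length is) \<Longrightarrow> cable_word w is \<in> bwords (sum_list is)"
proof (induction w arbitrary: "is")
  case (Cons x w)
  obtain k e where x: "x = (k, e)" by (cases x)
  with Cons.prems have k: "0 < k" "k < length is" and w: "w \<in> bwords (length is)" by auto
  obtain us a b vs where s: "is = us @ a # b # vs" "k = Suc (length us)"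
    by (rule split_at_crossing[OF k])
  have "cable_letter is (k, e) \<in> bwords (sum_list is)"
    by (cases e) (simp_all only: s cable_letter_split, auto intro: inv_word_bwords)
  then show ?case
    using w Cons.IH[of "us @ b # a # vs"] by (simp add: s x swap_at_split ac_simps)
qed simp

section \<open>Cabling respects the braid relations\<close>

lemma cable_far:
  assumes "0 < i" "Suc i < j" "j < length is"
  shows "permute [(i, True), (j, True)] is = permute [(j, True), (i, True)] is"
    and "cable_word [(i, True), (j, True)] is \<approx>\<^bsub>sum_list is\<^esub> cable_word [(j, True), (i, True)] is"
proof -
  obtain ps c d ws where j: "is = ps @ c # d # ws" "j = Suc (length ps)"
    by (rule split_at_crossing[of j "is"]) (use assms in simp_all)
  obtain us a b vs where i: "ps = us @ a # b # vs" "i = Suc (length us)"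
    by (rule split_at_crossing[of i ps]) (use assms j in simp_all)
  have "is": "is = us @ a # b # vs @ c # d # ws" by (simp add: i j)
  have si: "swap_at i (us @ x # y # zs) = us @ y # x # zs" for x y and zs :: "nat list"
    unfolding i by (rule swap_at_split)
  have sj: "swap_at j (us @ x # y # vs @ c # d # ws) = us @ x # y # vs @ d # c # ws" for x y
    using swap_at_split[of "us @ x # y # vs" c d ws] by (simp add: i j)
  have ci: "cable_letter (us @ x # y # zs) (i, True) = cross_word (sum_list us) x y" for x y zs
    unfolding i by (rule cable_letter_split)
  have cj: "cable_letter (us @ x # y # vs @ c # d # ws) (j, True)
      = cross_word (sum_list us + x + y + sum_list vs) c d" for x y
    using cable_letter_split(1)[of "us @ x # y # vs" c d ws] by (simp add: i j add.assoc)
  show "permute [(i, True), (j, True)] is = permute [(j, True), (i, True)] is"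
    by (simp add: "is" si sj)
  have "cross_word (sum_list us) a b @ cross_word (sum_list us + a + b + sum_list vs) c d
    \<approx>\<^bsub>sum_list is\<^esub> cross_word (sum_list us + a + b + sum_list vs) c d @ cross_word (sum_list us) a b"
    by (rule disjoint_blocks_commute[OF cross_word_block cross_word_block]) (simp_all add: "is")
  then show "cable_word [(i, True), (j, True)] is
      \<approx>\<^bsub>sum_list is\<^esub> cable_word [(j, True), (i, True)] is"
    by (simp add: "is" si sj ci cj ac_simps del: cable_letter.simps)
qed

lemma cable_braid:
  assumes "0 < i" "Suc i < length is"
  defines "u \<equiv> [(i, True), (Suc i, True), (i, True)]"
    and "v \<equiv> [(Suc i, True), (i, True), (Suc i, True)]"
  shows "permute u is = permute v is" and "cable_word u is \<approx>\<^bsub>sum_list is\<^esub> cable_word v is"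
proof -
  obtain ps b c vs where j: "is = ps @ b # c # vs" "Suc i = Suc (length ps)"
    by (rule split_at_crossing[of "Suc i" "is"]) (use assms in simp_all)
  obtain us a where ps: "ps = us @ [a]" using j assms by (cases ps rule: rev_cases) auto
  have "is": "is = us @ a # b # c # vs" and i: "i = Suc (length us)" using j by (simp_all add: ps)
  have s1: "swap_at i (us @ x # y # zs) = us @ y # x # zs" for x y and zs :: "nat list"
    unfolding i by (rule swap_at_split)
  have s2: "swap_at (Suc i) (us @ x # y # z # zs) = us @ x # z # y # zs" for x y z and zs :: "nat list"
    using swap_at_split[of "us @ [x]" y z zs] by (simp add: i)
  have c1: "cable_letter (us @ x # y # zs) (i, True) = cross_word (sum_list us) x y" for x y zs
    unfolding i by (rule cable_letter_split)
  have c2: "cable_letter (us @ x # y # z # zs) (Suc i, True) = cross_word (sum_list us + x) y z"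
    for x y z zs
    using cable_letter_split(1)[of "us @ [x]" y z zs] by (simp add: i)
  show "permute u is = permute v is"
    by (simp add: u_def v_def "is" s1 s2)
  have "sum_list us + a + b + c \<le> sum_list is" by (simp add: "is")
  from cross_word_braid[OF this]
  show "cable_word u is \<approx>\<^bsub>sum_list is\<^esub> cable_word v is"
    by (simp add: u_def v_def "is" s1 s2 c1 c2 del: cable_letter.simps)
qed

lemma cable_letter_swap:
  assumes "0 < k" "k < length is"
  shows "cable_letter (swap_at k is) (k, \<not> e) = inv_word (cable_letter is (k, e))"
proof -
  obtain us a b vs where s: "is = us @ a # b # vs" "k = Suc (length us)"
    by (rule split_at_crossing[OF assms])
  show ?thesis
    by (cases e) (simp_all add: s swap_at_split cable_letter_split del: cable_letter.simps)
qed

lemma swap_at_swap_at: "0 < k \<Longrightarrow> k < length xs \<Longrightarrow> swap_at k (swap_at k xs) = xs"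
  by (erule (1) split_at_crossing) (simp add: swap_at_split)

text \<open>
  The two words must also induce the same permutation of the sizes: without it the induction fails
  at a product, where the second factor is cabled with the sizes permuted by the first.
\<close>

lemma cable_word_respects:
  assumes "u \<approx>\<^bsub>length is\<^esub> v"
  shows "permute u is = permute v is \<and> cable_word u is \<approx>\<^bsub>sum_list is\<^esub> cable_word v is"
proof -
  have "length is = m \<Longrightarrow>
      permute u is = permute v is \<and> cable_word u is \<approx>\<^bsub>sum_list is\<^esub> cable_word v is"
    if "(u, v) \<in> braid_rel m" for m
    using that
  proof (induction arbitrary: "is" rule: braid_rel.induct)
    case (refl w)
    then show ?case by (simp add: braid_eq_refl cable_word_bwords)
  next
    case (sym u v)
    then show ?case by (simp add: braid_eq_sym)
  next
    case (trans u v w)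
    then show ?case by (metis braid_eq_trans)
  next
    case (cong u v u' v')
    have "u \<in> bwords (length is)" using cong braid_rel_bwords by blast
    then have "cable_word u' (permute u is) \<approx>\<^bsub>sum_list is\<^esub> cable_word v' (permute u is)"
      using cong.IH(2)[of "permute u is"] cong.prems by (simp add: sum_list_permute)
    then show ?case
      using cong by (simp add: cable_word_append permute_append braid_eq_append)
  next
    case (cancel i e)
    then have i: "0 < i" "i < length is" by auto
    have "cable_letter is (i, e) \<in> bwords (sum_list is)"
      using cable_word_bwords[of "[(i, e)]" "is"] i by simp
    then show ?case
      using i by (simp add: cable_letter_swap swap_at_swap_at braid_eq_inv_right)
  next
    case (far i j)
    then consider "Suc i < j" | "Suc j < i" by linarith
    then show ?case
    proof cases
      case 1
      then show ?thesis using cable_far[of i j "is"] far by auto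
    next
      case 2
      then show ?thesis using cable_far[of j i "is"] far by (auto intro: braid_eq_sym)
    qed
  next
    case (braid i)
    then show ?case using cable_braid[of i "is"] by auto
  qed
  then show ?thesis using assms by (simp add: braid_eq_def)
qed

section \<open>Cabling a cabled braid\<close>

lemma length_swap_at [simp]: "length (swap_at k xs) = length xs"
  by (simp add: swap_at_def)

lemma permute_inv_word:
  "w \<in> bwords (length xs) \<Longrightarrow> permute (inv_word w) (permute w xs) = xs"
proof (induction w arbitrary: xs)
  case (Cons x w)
  obtain k e where "x = (k, e)" by (cases x)
  then show ?case
    using Cons.prems Cons.IH[of "swap_at k xs"] by (simp add: permute_append swap_at_swap_at)
qed simp

lemma cable_inv_word:
  "w \<in> bwords (length is) \<Longrightarrow>
    cable_word (inv_word w) (permute w is) = inv_word (cable_word w is)"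
proof (induction w arbitrary: "is")
  case (Cons x w)
  obtain k e where x: "x = (k, e)" by (cases x)
  with Cons.prems have k: "0 < k" "k < length is" and w: "w \<in> bwords (length (swap_at k is))"
    by auto
  show ?case
    using Cons.IH[OF w] permute_inv_word[OF w] cable_letter_swap[OF k, of e]
    by (simp add: x cable_word_append)
qed simp

lemma braid_eq_inv_word: "u \<approx>\<^bsub>m\<^esub> v \<Longrightarrow> inv_word u \<approx>\<^bsub>m\<^esub> inv_word v"
  using braid_eq_conjugate_inv[of m u "[]" v] by simp

text \<open>
  Cabling \<open>\<delta>\<close>, which passes several cables over one: by induction on these cables, the crossings with
  the single cable merge one portion at a time.
\<close>

lemma cable_delta:
  fixes xs as ys :: "nat list"
  defines "w \<equiv> \<lambda>(xs :: nat list) (as :: nat list). delta_word (Suc (length xs)) (Suc (length xs + length as))"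
  assumes "sum_list xs + sum_list as + b \<le> m"
  shows "cable_word (w xs as) (xs @ as @ b # ys) \<approx>\<^bsub>m\<^esub> cross_word (sum_list xs) (sum_list as) b
    \<and> permute (w xs as) (xs @ as @ b # ys) = xs @ b # as @ ys"
  using assms(2)
proof (induction as arbitrary: xs)
  case Nil
  show ?case by (simp add: w_def braid_eq_refl)
next
  case (Cons a as)
  have w: "w xs (a # as) = w (xs @ [a]) as @ [(Suc (length xs), True)]"
    using delta_word_split[of "Suc (length xs)" "Suc (Suc (length xs))"] by (simp add: w_def)
  have IH: "cable_word (w (xs @ [a]) as) (xs @ a # as @ b # ys)
        \<approx>\<^bsub>m\<^esub> cross_word (sum_list xs + a) (sum_list as) b"
    and p: "permute (w (xs @ [a]) as) (xs @ a # as @ b # ys) = xs @ a # b # as @ ys"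
    using Cons.IH[of "xs @ [a]"] Cons.prems by (simp_all add: add.assoc)
  have "cable_word (w xs (a # as)) (xs @ a # as @ b # ys)
      \<approx>\<^bsub>m\<^esub> cross_word (sum_list xs + a) (sum_list as) b @ cross_word (sum_list xs) a b"
    using braid_eq_append[OF IH braid_eq_refl[of "cross_word (sum_list xs) a b"]] Cons.prems
    by (simp add: w cable_word_append p cable_letter_split del: cable_letter.simps)
  also have "\<dots> \<approx>\<^bsub>m\<^esub> cross_word (sum_list xs) (a + sum_list as) b"
    by (rule braid_eq_sym[OF cross_word_add_left]) (use Cons.prems in simp)
  finally show ?case by (simp add: w permute_append p swap_at_split)
qed

text \<open>
  Cabling the crossing of two cables gives the crossing of the two cables of cables. The lower cable
  is treated strand by strand, each strand being the case of \<open>cable_delta\<close>.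
\<close>

lemma cable_cross:
  fixes xs as bs ys :: "nat list"
  defines "w \<equiv> \<lambda>(xs :: nat list) (bs :: nat list). cross_word (length xs) (length as) (length bs)"
  assumes "sum_list xs + sum_list as + sum_list bs \<le> m"
  shows "cable_word (w xs bs) (xs @ as @ bs @ ys)
      \<approx>\<^bsub>m\<^esub> cross_word (sum_list xs) (sum_list as) (sum_list bs)
    \<and> permute (w xs bs) (xs @ as @ bs @ ys) = xs @ bs @ as @ ys"
  using assms(2)
proof (induction bs arbitrary: xs)
  case Nil
  show ?case by (simp add: w_def braid_eq_refl)
next
  case (Cons b bs)
  let ?d = "delta_word (Suc (length xs)) (Suc (length xs + length as))"
  have w: "w xs (b # bs) = ?d @ w (xs @ [b]) bs"
    using cross_word_add_right[of "length xs" "length as" 1 "length bs"]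
    by (simp add: w_def cross_word_1)
  have D: "cable_word ?d (xs @ as @ b # bs @ ys) \<approx>\<^bsub>m\<^esub> cross_word (sum_list xs) (sum_list as) b"
    and p: "permute ?d (xs @ as @ b # bs @ ys) = xs @ b # as @ bs @ ys"
    using cable_delta[of xs as b m "bs @ ys"] Cons.prems by simp_all
  have IH: "cable_word (w (xs @ [b]) bs) (xs @ b # as @ bs @ ys)
        \<approx>\<^bsub>m\<^esub> cross_word (sum_list xs + b) (sum_list as) (sum_list bs)"
    and q: "permute (w (xs @ [b]) bs) (xs @ b # as @ bs @ ys) = xs @ b # bs @ as @ ys"
    using Cons.IH[of "xs @ [b]"] Cons.prems by (simp_all add: add.assoc add.left_commute)
  show ?case
    using braid_eq_append[OF D IH]
    by (simp add: w cable_word_append permute_append p q cross_word_add_right)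
qed

lemma sum_list_concat: "sum_list (concat jss) = sum_list (map sum_list jss)"
  by (induction jss) simp_all

text \<open>
  For a negative letter, the word is the inverse of a crossing that starts from the sizes in exchanged
  order. Hence \<open>cable_cross\<close> is applied to the list with the two blocks exchanged.
\<close>

lemma cable_cable_letter:
  fixes e :: bool
  assumes "0 < k" "k < length jss"
  defines "w \<equiv> cable_letter (map length jss) (k, e)"
  shows "cable_word w (concat jss)
      \<approx>\<^bsub>sum_list (concat jss)\<^esub> cable_letter (map sum_list jss) (k, e)
    \<and> permute w (concat jss) = concat (swap_at k jss)"
proof -
  obtain us A B vs where s: "jss = us @ A # B # vs" "k = Suc (length us)"
    by (rule split_at_crossing[OF assms(1,2)])
  have sw: "swap_at k jss = us @ B # A # vs" by (simp add: s swap_at_split)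
  show ?thesis
  proof (cases e)
    case True
    then show ?thesis
      using cable_cross[of "concat us" A B "sum_list (concat jss)" "concat vs"]
        cable_letter_split(1)[of "map length us" "length A" "length B" "map length vs"]
        cable_letter_split(1)[of "map sum_list us" "sum_list A" "sum_list B" "map sum_list vs"]
      unfolding w_def sw
      by (simp add: s length_concat sum_list_concat del: cable_letter.simps)
  next
    case False
    let ?c = "cross_word (length (concat us)) (length B) (length A)"
    let ?js = "concat us @ B @ A @ concat vs"
    have c: "?c \<in> bwords (length ?js)" by simp
    have *: "cable_word ?c ?js
          \<approx>\<^bsub>sum_list (concat jss)\<^esub> cross_word (sum_list (concat us)) (sum_list B) (sum_list A)"
      and p: "permute ?c ?js = concat us @ A @ B @ concat vs"
      using cable_cross[of "concat us" B A "sum_list (concat jss)" "concat vs"] by (simp_all add: s)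
    show ?thesis
      using False cable_inv_word[OF c] permute_inv_word[OF c] braid_eq_inv_word[OF *]
        cable_letter_split(2)[of "map length us" "length A" "length B" "map length vs"]
        cable_letter_split(2)[of "map sum_list us" "sum_list A" "sum_list B" "map sum_list vs"]
      unfolding w_def sw p
      by (simp add: s length_concat sum_list_concat del: cable_letter.simps)
  qed
qed

lemma map_swap_at: "0 < k \<Longrightarrow> k < length xs \<Longrightarrow> map f (swap_at k xs) = swap_at k (map f xs)"
  by (simp add: swap_at_def map_update)

text \<open>
  The statement about permutations is what provides the sizes for the remaining letters: a cabled
  letter moves the blocks of sizes as a whole.
\<close>

lemma cable_cable_word:
  assumes "w \<in> bwords (length jss)"
  shows "cable_word (cable_word w (map length jss)) (concat jss)
      \<approx>\<^bsub>sum_list (concat jss)\<^esub> cable_word w (map sum_list jss)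
    \<and> permute (cable_word w (map length jss)) (concat jss) = concat (permute w jss)"
  using assms
proof (induction w arbitrary: jss)
  case Nil
  show ?case by (simp add: braid_eq_refl)
next
  case (Cons x w)
  obtain k e where x: "x = (k, e)" by (cases x)
  with Cons.prems have k: "0 < k" "k < length jss" and w: "w \<in> bwords (length (swap_at k jss))"
    by auto
  have "sum_list (permute [x] (map sum_list jss)) = sum_list (map sum_list jss)"
    using k by (intro sum_list_permute) (simp add: x)
  then have S: "sum_list (concat (swap_at k jss)) = sum_list (concat jss)"
    using k by (simp add: x sum_list_concat map_swap_at)
  note C = cable_cable_letter[OF k, of e] and IH = Cons.IH[OF w, unfolded S]
  show ?case
    using braid_eq_append[OF conjunct1[OF C] conjunct1[OF IH]] conjunct2[OF C] conjunct2[OF IH] k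
    by (simp add: x cable_word_append permute_append map_swap_at del: cable_letter.simps)
qed

section \<open>Juxtaposition\<close>

abbreviation braid_tuple :: "nat list \<Rightarrow> bword list \<Rightarrow> bool" where
  "braid_tuple \<equiv> list_all2 (\<lambda>i w. w \<in> bwords i)"

lemma juxt_word_bwords: "braid_tuple is ws \<Longrightarrow> juxt_word is ws \<in> bwords (sum_list is)"
  by (induction rule: list_all2_induct) (auto intro: bwords_mono bwords_shift)

lemma juxt_word_append:
  "length us = length is \<Longrightarrow>
    juxt_word (is @ js) (us @ vs) = juxt_word is us @ shift_word (sum_list is) (juxt_word js vs)"
  by (induction us "is" rule: list_induct2) simp_all

lemma juxt_word_concat:
  "list_all2 braid_tuple jss wss \<Longrightarrow>
    juxt_word (concat jss) (concat wss) = juxt_word (map sum_list jss) (map2 juxt_word jss wss)"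
  by (induction rule: list_all2_induct) (simp_all add: juxt_word_append list_all2_lengthD)

text \<open>
  The interchange law \<open>(\<oplus> u\<^sub>i)(\<oplus> v\<^sub>i) = \<oplus> u\<^sub>i v\<^sub>i\<close>: the first factor \<open>v\<^sub>1\<close> has to pass the later \<open>u\<^sub>i\<close>,
  which live on disjoint strands.
\<close>

lemma juxt_word_mult:
  assumes "braid_tuple is us" "braid_tuple is vs"
  shows "juxt_word is us @ juxt_word is vs \<approx>\<^bsub>sum_list is\<^esub> juxt_word is (map2 (@) us vs)"
  using assms
proof (induction arbitrary: vs rule: list_all2_induct)
  case Nil
  then show ?case by (simp add: braid_eq_refl)
next
  case (Cons i "is" u us)
  then obtain v vs' where vs: "vs = v # vs'" and v: "v \<in> bwords i" and vs': "braid_tuple is vs'"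
    by (auto simp: list_all2_Cons1)
  let ?m = "i + sum_list is" and ?U = "shift_word i (juxt_word is us)"
    and ?V = "shift_word i (juxt_word is vs')"
  have [simp]: "u \<in> bwords ?m" "v \<in> bwords ?m" "?V \<in> bwords ?m"
    using Cons.hyps v vs' by (auto intro: bwords_mono bwords_shift juxt_word_bwords)
  have "v @ ?U \<approx>\<^bsub>?m\<^esub> ?U @ v"
    using disjoint_blocks_commute[of v 0 i ?U i ?m] v block_words_shift[OF juxt_word_bwords] Cons.hyps
    by (simp add: bwords_block)
  from braid_eq_within[OF braid_eq_sym[OF this], of u ?V]
  have "juxt_word (i # is) (u # us) @ juxt_word (i # is) vs \<approx>\<^bsub>?m\<^esub> (u @ v) @ (?U @ ?V)"
    by (simp add: vs)
  also have "?U @ ?V = shift_word i (juxt_word is us @ juxt_word is vs')" by simp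
  also have "(u @ v) @ \<dots> \<approx>\<^bsub>?m\<^esub> (u @ v) @ shift_word i (juxt_word is (map2 (@) us vs'))"
    by (intro braid_eq_append braid_eq_refl braid_eq_shift[OF Cons.IH[OF vs']]) simp_all
  finally show ?case by (simp add: vs)
qed

lemma cable_word_left:
  "w \<in> bwords (length is) \<Longrightarrow>
    cable_word w (is @ js) = cable_word w is \<and> permute w (is @ js) = permute w is @ js"
proof (induction w arbitrary: "is")
  case (Cons x w)
  obtain k e where x: "x = (k, e)" by (cases x)
  with Cons.prems have k: "0 < k" "k < length is" and w: "w \<in> bwords (length is)" by auto
  obtain us a b vs where s: "is = us @ a # b # vs" "k = Suc (length us)"
    by (rule split_at_crossing[OF k])
  show ?case
    using w Cons.IH[of "us @ b # a # vs"]
    by (cases e) (simp_all add: s x swap_at_split cable_letter_split del: cable_letter.simps)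
qed simp

lemma cable_word_right:
  "w \<in> bwords (length js) \<Longrightarrow>
    cable_word (shift_word (length is) w) (is @ js) = shift_word (sum_list is) (cable_word w js)
    \<and> permute (shift_word (length is) w) (is @ js) = is @ permute w js"
proof (induction w arbitrary: js)
  case (Cons x w)
  obtain k e where x: "x = (k, e)" by (cases x)
  with Cons.prems have k: "0 < k" "k < length js" and w: "w \<in> bwords (length js)" by auto
  obtain us a b vs where s: "js = us @ a # b # vs" "k = Suc (length us)"
    by (rule split_at_crossing[OF k])
  have s': "is @ js = (is @ us) @ a # b # vs" "k + length is = Suc (length (is @ us))"
    by (simp_all add: s)
  have "cable_letter (is @ js) (k + length is, e) = shift_word (sum_list is) (cable_letter js (k, e))"
    unfolding s' cable_letter_split unfolding s
    by (cases e) (simp_all only: cable_letter_split shift_word_inv_word shift_cross_word sum_list_append)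
  moreover have "swap_at (k + length is) (is @ js) = is @ us @ b # a # vs"
    unfolding s' swap_at_split by simp
  ultimately show ?case
    using w Cons.IH[of "us @ b # a # vs"]
    by (simp add: s x swap_at_split del: cable_letter.simps)
qed simp

text \<open>
  An equality of words: each summand only permutes the sizes in its own block, so the total size of
  the blocks to its left, by which the next summand is shifted, does not change.
\<close>

lemma cable_juxt_word:
  "braid_tuple (map length jss) ws \<Longrightarrow>
    cable_word (juxt_word (map length jss) ws) (concat jss)
      = juxt_word (map sum_list jss) (map2 cable_word ws jss)
    \<and> permute (juxt_word (map length jss) ws) (concat jss) = concat (map2 permute ws jss)"
proof (induction jss arbitrary: ws)
  case (Cons js jss)
  then obtain w ws' where ws: "ws = w # ws'" and w: "w \<in> bwords (length js)"
    and ws': "braid_tuple (map length jss) ws'"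
    by (auto simp: list_all2_Cons1)
  have "juxt_word (map length jss) ws' \<in> bwords (length (concat jss))"
    using juxt_word_bwords[OF ws'] by (simp add: length_concat)
  from cable_word_right[OF this, of "permute w js"] cable_word_left[OF w, of "concat jss"]
  show ?case
    using Cons.IH[OF ws'] w
    by (simp add: ws cable_word_append permute_append sum_list_permute)
qed simp

section \<open>Composition of words\<close>

definition comp_word :: "nat list \<Rightarrow> bword \<Rightarrow> bword list \<Rightarrow> bword" where
  "comp_word is w ws = juxt_word is ws @ cable_word w is"

lemma comp_word_bwords:
  "w \<in> bwords (length is) \<Longrightarrow> braid_tuple is ws \<Longrightarrow> comp_word is w ws \<in> bwords (sum_list is)"
  by (simp add: comp_word_def cable_word_bwords juxt_word_bwords)

text \<open>
  Both sides reduce to the juxtaposition of the innermost words, followed by the juxtaposition of the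
  cabled \<open>u\<^sub>k\<close>, followed by the cabled \<open>w\<close>. On the left, \<open>w\<close> is cabled twice, and the sizes it meets in
  the second cabling have been permuted within the blocks by the \<open>u\<^sub>k\<close>; this changes neither the length
  nor the sum of a block, which are all that the twofold cabling of \<open>w\<close> depends on.
\<close>

lemma comp_word_assoc:
  assumes w: "w \<in> bwords (length jss)" and us: "braid_tuple (map length jss) us"
    and vss: "list_all2 braid_tuple jss vss"
  shows "comp_word (concat jss) (comp_word (map length jss) w us) (concat vss)
    \<approx>\<^bsub>sum_list (concat jss)\<^esub>
    comp_word (map sum_list jss) w
      (map (\<lambda>k. comp_word (jss ! k) (us ! k) (vss ! k)) [0..<length jss])"
proof -
  let ?n = "length jss" and ?sums = "map sum_list jss" and ?jss' = "map2 permute us jss"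
  let ?V = "map2 juxt_word jss vss" and ?U = "map2 cable_word us jss"
  have len: "length us = ?n" "length vss = ?n" using us vss list_all2_lengthD by fastforce+
  have nth: "us ! k \<in> bwords (length (jss ! k))" "braid_tuple (jss ! k) (vss ! k)" if "k < ?n" for k
    using us vss that by (auto simp: list_all2_conv_all_nth)
  have V: "braid_tuple ?sums ?V" and U: "braid_tuple ?sums ?U"
    using nth by (auto simp: list_all2_conv_all_nth len intro: juxt_word_bwords cable_word_bwords)
  \<comment> \<open>Permuting within the blocks preserves their lengths and sums.\<close>
  have lengths: "map length ?jss' = map length jss" and sums: "map sum_list ?jss' = ?sums"
    using nth by (auto intro!: nth_equalityI simp: len sum_list_permute)
  have cat: "map2 (@) ?V ?U = map (\<lambda>k. comp_word (jss ! k) (us ! k) (vss ! k)) [0..<?n]"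
    by (rule nth_equalityI) (simp_all add: len comp_word_def)
  have "cable_word (comp_word (map length jss) w us) (concat jss)
      = juxt_word ?sums ?U @ cable_word (cable_word w (map length ?jss')) (concat ?jss')"
    using cable_juxt_word[OF us] unfolding lengths by (simp add: comp_word_def cable_word_append)
  then have "comp_word (concat jss) (comp_word (map length jss) w us) (concat vss)
      = (juxt_word ?sums ?V @ juxt_word ?sums ?U)
        @ cable_word (cable_word w (map length ?jss')) (concat ?jss')"
    by (simp add: comp_word_def[of "concat jss"] juxt_word_concat[OF vss])
  also have "\<dots> \<approx>\<^bsub>sum_list (concat jss)\<^esub>
      juxt_word ?sums (map2 (@) ?V ?U) @ cable_word w (map sum_list ?jss')"
  proof (rule braid_eq_append)
    show "juxt_word ?sums ?V @ juxt_word ?sums ?U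
        \<approx>\<^bsub>sum_list (concat jss)\<^esub> juxt_word ?sums (map2 (@) ?V ?U)"
      unfolding sum_list_concat by (rule juxt_word_mult[OF V U])
    have "sum_list (concat jss) = sum_list (concat ?jss')"
      unfolding sum_list_concat sums ..
    then show "cable_word (cable_word w (map length ?jss')) (concat ?jss')
        \<approx>\<^bsub>sum_list (concat jss)\<^esub> cable_word w (map sum_list ?jss')"
      using cable_cable_word[of w ?jss'] w by (simp add: len)
  qed
  finally show ?thesis unfolding sums cat by (simp add: comp_word_def)
qed

section \<open>The braid operad\<close>

lemma braid_class_eqI: "u \<approx>\<^bsub>m\<^esub> v \<Longrightarrow> braid_class m u = braid_class m v"
  unfolding braid_eq_def by (rule equiv_class_eq[OF equiv_braid_rel])

lemma UN_constant_eq: "a \<in> A \<Longrightarrow> (\<And>x. x \<in> A \<Longrightarrow> f x = f a) \<Longrightarrow> (\<Union>x\<in>A. f x) = f a"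
  by blast

text \<open>
  The union over representatives in \<open>cable\<close> is a single class because cabling respects the braid
  relations; likewise for \<open>juxt\<close> below.
\<close>

lemma cable_braid_class:
  assumes "w \<in> bwords (length is)"
  shows "cable (braid_class (length is) w) is = braid_class (sum_list is) (cable_word w is)"
  unfolding cable_def
proof (rule UN_constant_eq)
  show "w \<in> braid_class (length is) w" using assms by (simp add: braid_rel.refl)
  show "braid_class (sum_list is) (cable_word v is) = braid_class (sum_list is) (cable_word w is)"
    if "v \<in> braid_class (length is) w" for v
    using that cable_word_respects[of "is" w v]
    by (intro braid_class_eqI) (auto simp: braid_eq_def intro: braid_rel.sym)
qed

lemma juxt_word_respects:
  "braid_tuple is ws \<Longrightarrow> vs \<in> listset (map2 braid_class is ws) \<Longrightarrow>
    juxt_word is vs \<approx>\<^bsub>sum_list is\<^esub> juxt_word is ws"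
proof (induction arbitrary: vs rule: list_all2_induct)
  case Nil
  then show ?case by (simp add: braid_eq_refl)
next
  case (Cons i "is" w ws)
  then obtain v vs' where vs: "vs = v # vs'" and v: "w \<approx>\<^bsub>i\<^esub> v"
    and vs': "vs' \<in> listset (map2 braid_class is ws)"
    by (auto simp: set_Cons_def braid_eq_def)
  show ?case
    using braid_eq_append[OF braid_eq_mono[OF braid_eq_sym[OF v]] braid_eq_shift[OF Cons.IH[OF vs']]]
    by (simp add: vs)
qed

lemma listset_braid_class:
  "braid_tuple is ws \<Longrightarrow> ws \<in> listset (map2 braid_class is ws)"
  by (induction rule: list_all2_induct) (auto simp: set_Cons_def intro: braid_rel.refl)

lemma juxt_braid_class:
  assumes "braid_tuple is ws"
  shows "juxt is (map2 braid_class is ws) = braid_class (sum_list is) (juxt_word is ws)"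
  unfolding juxt_def
  by (intro UN_constant_eq listset_braid_class[OF assms] braid_class_eqI juxt_word_respects[OF assms])

lemma braid_comp_class:
  assumes "w \<in> bwords (length is)" "braid_tuple is ws"
  shows "braid_comp is (braid_class (length is) w) (map2 braid_class is ws)
    = braid_class (sum_list is) (comp_word is w ws)"
  using assms
  by (simp add: braid_comp_def cable_braid_class juxt_braid_class braid_mult_class comp_word_def
      cable_word_bwords juxt_word_bwords)

lemma ops_braid_operad:
  "ops braid_operad n = (if n = 0 then {} else braid_class n ` bwords n)"
  by (auto simp: braid_operad_def braid_group_def quotient_def)

lemma op_unit_braid_operad: "op_unit braid_operad = braid_class 1 []"
  by (simp add: braid_operad_def braid_group_def)

lemma op_comp_braid_operad: "op_comp braid_operad = braid_comp"
  by (simp add: braid_operad_def)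

lemma op_args_braid_operadE:
  assumes "op_args (ops braid_operad) is ys"
  obtains ws where "braid_tuple is ws" "ys = map2 braid_class is ws" "\<forall>i\<in>set is. 0 < i"
proof -
  have "\<exists>ws. braid_tuple is ws \<and> ys = map2 braid_class is ws \<and> (\<forall>i\<in>set is. 0 < i)"
    using assms unfolding op_args_def
  proof (induction rule: list_all2_induct)
    case (Cons i "is" y ys)
    then obtain ws w where "braid_tuple is ws" "ys = map2 braid_class is ws" "\<forall>i\<in>set is. 0 < i"
      "w \<in> bwords i" "y = braid_class i w" "0 < i"
      by (auto simp: ops_braid_operad split: if_splits)
    then show ?case by (intro exI[of _ "w # ws"]) simp
  qed simp
  then show thesis using that by blast
qed

lemma op_args_braid_operad_listE:
  assumes "list_all2 (op_args (ops braid_operad)) jss zss"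
  obtains wss where "list_all2 braid_tuple jss wss" "zss = map2 (map2 braid_class) jss wss"
proof -
  have "\<exists>wss. list_all2 braid_tuple jss wss \<and> zss = map2 (map2 braid_class) jss wss"
    using assms
  proof (induction rule: list_all2_induct)
    case (Cons js jss zs zss)
    obtain ws where "braid_tuple js ws" "zs = map2 braid_class js ws"
      using Cons.hyps(1) by (rule op_args_braid_operadE)
    moreover obtain wss where "list_all2 braid_tuple jss wss" "zss = map2 (map2 braid_class) jss wss"
      using Cons.IH by blast
    ultimately show ?case by (intro exI[of _ "ws # wss"]) simp
  qed simp
  then show thesis using that by blast
qed

lemma concat_map2:
  "list_all2 (\<lambda>xs ys. length xs = length ys) xss yss \<Longrightarrow>
    concat (map2 (map2 f) xss yss) = map2 f (concat xss) (concat yss)"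
  by (induction rule: list_all2_induct) simp_all

lemma list_all2_concat: "list_all2 (list_all2 P) xss yss \<Longrightarrow> list_all2 P (concat xss) (concat yss)"
  by (induction rule: list_all2_induct) (simp_all add: list_all2_appendI)

lemma swap_at_replicate [simp]: "swap_at k (replicate n x) = replicate n x" if "k < n"
  using that by (auto simp: swap_at_def intro!: nth_equalityI simp: nth_list_update)

lemma cable_word_replicate_1: "w \<in> bwords n \<Longrightarrow> cable_word w (replicate n 1) = w"
proof (induction w)
  case (Cons x w)
  obtain k e where x: "x = (k, e)" by (cases x)
  then show ?case
    using Cons by (cases e) (auto simp: sum_list_replicate cross_word_1)
qed simp

lemma juxt_word_replicate_Nil [simp]: "juxt_word (replicate n i) (replicate n []) = []"
  by (induction n) simp_all

lemma ns_operad_braid_operad: "ns_operad braid_operad"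
proof
  show "op_unit braid_operad \<in> ops braid_operad 1"
    by (simp add: ops_braid_operad op_unit_braid_operad)
next
  fix x "is" ys
  assume "x \<in> ops braid_operad (length is)" and ys: "op_args (ops braid_operad) is ys"
  then obtain w where w: "w \<in> bwords (length is)" "x = braid_class (length is) w" and "is \<noteq> []"
    by (auto simp: ops_braid_operad split: if_splits)
  moreover obtain ws where ws: "braid_tuple is ws" "ys = map2 braid_class is ws" "\<forall>i\<in>set is. 0 < i"
    using ys by (rule op_args_braid_operadE)
  ultimately have "sum_list is \<noteq> 0" by (cases "is") auto
  then show "op_comp braid_operad is x ys \<in> ops braid_operad (sum_list is)"
    using w ws by (auto simp: ops_braid_operad op_comp_braid_operad braid_comp_class comp_word_bwords)
next
  fix x n
  assume "x \<in> ops braid_operad n"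
  then obtain w where w: "w \<in> bwords n" "x = braid_class n w"
    by (auto simp: ops_braid_operad split: if_splits)
  show "op_comp braid_operad [n] (op_unit braid_operad) [x] = x"
    using braid_comp_class[of "[]" "[n]" "[w]"] w
    by (simp add: op_comp_braid_operad op_unit_braid_operad comp_word_def)
  show "op_comp braid_operad (replicate n 1) x (replicate n (op_unit braid_operad)) = x"
    using braid_comp_class[of w "replicate n 1" "replicate n []"] w cable_word_replicate_1[OF w(1)]
    by (simp add: op_comp_braid_operad op_unit_braid_operad comp_word_def sum_list_replicate
        list_all2_conv_all_nth zip_replicate)
next
  fix x jss ys zss
  assume "x \<in> ops braid_operad (length jss)"
    and ys: "op_args (ops braid_operad) (map length jss) ys"
    and zss: "list_all2 (op_args (ops braid_operad)) jss zss"
  then obtain w where w: "w \<in> bwords (length jss)" "x = braid_class (length jss) w"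
    by (auto simp: ops_braid_operad split: if_splits)
  obtain us where us: "braid_tuple (map length jss) us" "ys = map2 braid_class (map length jss) us"
    using ys by (rule op_args_braid_operadE)
  obtain vss where vss: "list_all2 braid_tuple jss vss" "zss = map2 (map2 braid_class) jss vss"
    using zss by (rule op_args_braid_operad_listE)
  let ?cs = "map (\<lambda>k. comp_word (jss ! k) (us ! k) (vss ! k)) [0..<length jss]"
  have len: "length us = length jss" "length vss = length jss"
    using us(1) vss(1) list_all2_lengthD by fastforce+
  have nth: "us ! k \<in> bwords (length (jss ! k))" "braid_tuple (jss ! k) (vss ! k)"
    if "k < length jss" for k
    using us(1) vss(1) that by (auto simp: list_all2_conv_all_nth)
  have zs: "concat zss = map2 braid_class (concat jss) (concat vss)"
    unfolding vss(2) using vss(1)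
    by (intro concat_map2) (auto elim: list_all2_mono dest: list_all2_lengthD)
  have cs: "braid_tuple (map sum_list jss) ?cs"
    using nth by (auto simp: list_all2_conv_all_nth intro: comp_word_bwords)
  have inner: "braid_comp (map length jss) x ys
      = braid_class (length (concat jss)) (comp_word (map length jss) w us)"
    using braid_comp_class[of w "map length jss" us] w us by (simp add: length_concat)
  have outer: "map (\<lambda>k. braid_comp (jss ! k) (ys ! k) (zss ! k)) [0..<length jss]
      = map2 braid_class (map sum_list jss) ?cs"
    using nth by (intro nth_equalityI) (simp_all add: us(2) vss(2) len braid_comp_class)
  have "comp_word (map length jss) w us \<in> bwords (length (concat jss))"
    using comp_word_bwords[of w "map length jss" us] w us by (simp add: length_concat)
  then have "braid_comp (concat jss) (braid_comp (map length jss) x ys) (concat zss)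
      = braid_class (sum_list (concat jss))
          (comp_word (concat jss) (comp_word (map length jss) w us) (concat vss))"
    unfolding inner zs by (intro braid_comp_class list_all2_concat vss(1))
  also have "\<dots> = braid_class (sum_list (concat jss)) (comp_word (map sum_list jss) w ?cs)"
    by (intro braid_class_eqI comp_word_assoc w us vss)
  also have "\<dots> = braid_comp (map sum_list jss) x (map2 braid_class (map sum_list jss) ?cs)"
    using braid_comp_class[of w "map sum_list jss" ?cs] w cs by (simp add: sum_list_concat)
  finally show "op_comp braid_operad (concat jss) (op_comp braid_operad (map length jss) x ys) (concat zss)
      = op_comp braid_operad (map sum_list jss) x
          (map (\<lambda>k. op_comp braid_operad (jss ! k) (ys ! k) (zss ! k)) [0..<length jss])"
    by (simp only: op_comp_braid_operad outer)
qed

section \<open>Garside elements\<close>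

lemma garside_word_0 [simp]: "garside_word 0 = []"
  by (simp add: garside_word_def)

text \<open>
  The half twist pulls its last strand under all others to the left, then half-twists the rest.
\<close>

lemma garside_word_Suc:
  "garside_word (Suc m) = delta_word 1 (Suc m) @ shift_word 1 (garside_word m)"
proof (cases "m = 0")
  case True
  then show ?thesis by (simp add: garside_word_def)
next
  case False
  have "[1..<Suc m] = 1 # map Suc [1..<m]"
    using False by (simp add: upt_conv_Cons map_Suc_upt)
  moreover have "shift_word 1 (concat ws) = concat (map (shift_word 1) ws)" for ws
    by (induction ws) simp_all
  ultimately show ?thesis
    by (simp add: garside_word_def comp_def shift_delta_word)
qed

lemma garside_word_bwords [simp]: "garside_word m \<in> bwords m"
  by (induction m) (simp_all add: garside_word_Suc bwords_shift)

text \<open>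
  Induction on \<open>q\<close>: the first factor \<open>\<delta>\<^bsub>1,n+q+1\<^esub>\<close> splits into its part among the last \<open>q + 1\<close> strands, which
  completes \<open>\<Delta>\<^sub>q\<close> to \<open>\<Delta>\<^bsub>q+1\<^esub>\<close>, and its part under the first \<open>n\<close> strands, which commutes past the shifted
  \<open>\<Delta>\<^sub>q\<close> and completes the crossing.
\<close>

lemma garside_word_add:
  "garside_word (n + q) \<approx>\<^bsub>n + q\<^esub>
    shift_word n (garside_word q) @ cross_word 0 n q @ shift_word q (garside_word n)"
proof (induction q)
  case 0
  then show ?case by (simp add: braid_eq_refl)
next
  case (Suc q)
  let ?N = "n + Suc q"
  let ?d = "delta_word (Suc n) ?N" and ?e = "delta_word 1 (Suc n)"
  let ?G = "shift_word (Suc n) (garside_word q)"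
    and ?T = "cross_word 1 n q @ shift_word (Suc q) (garside_word n)"
  have [simp]: "shift_word (Suc q) (garside_word n) \<in> bwords (Suc (n + q))"
    by (rule bwords_shift[OF garside_word_bwords]) simp
  have comm: "?e @ ?G \<approx>\<^bsub>?N\<^esub> ?G @ ?e"
    by (rule disjoint_blocks_commute[OF delta_word_block[of 0]
          block_words_shift[OF garside_word_bwords]]) simp_all
  have "garside_word ?N = ?d @ ?e @ shift_word 1 (garside_word (n + q))"
    using delta_word_split[of 1 "Suc n" ?N] by (simp add: garside_word_Suc)
  also have "\<dots> \<approx>\<^bsub>?N\<^esub> ?d @ ?e @ ?G @ ?T"
    using braid_eq_append[OF braid_eq_refl[of "?d @ ?e"] braid_eq_shift[OF Suc.IH, of 1 ?N]]
    by (simp add: shift_cross_word)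
  also have "\<dots> \<approx>\<^bsub>?N\<^esub> ?d @ ?G @ ?e @ ?T"
    using braid_eq_within[OF comm, of ?d ?T] by simp
  also have "\<dots> = shift_word n (garside_word (Suc q)) @ cross_word 0 n (Suc q)
      @ shift_word (Suc q) (garside_word n)"
    using cross_word_add_right[of 0 n 1 q]
    by (simp add: garside_word_Suc shift_delta_word cross_word_1)
  finally show ?case .
qed

text \<open>
  Induction on the number of cables, splitting off the last one since it is the one that the first
  factor \<open>\<delta>\<^bsub>1,m\<^esub>\<close> of \<open>\<Delta>\<^sub>m\<close> moves. Below that crossing it is the leftmost cable, and the remaining
  factors of \<open>\<Delta>\<^sub>m\<close> are a shifted \<open>\<Delta>\<^bsub>m-1\<^esub>\<close> acting on the other cables in their original order.
\<close>

lemma comp_word_garside: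
  "comp_word is (garside_word (length is)) (map garside_word is) \<approx>\<^bsub>sum_list is\<^esub>
    garside_word (sum_list is)"
proof (induction "is" rule: rev_induct)
  case Nil
  then show ?case by (simp add: comp_word_def braid_eq_refl)
next
  case (snoc q "is")
  let ?m = "length is"
  let ?n = "sum_list is"
  let ?N = "?n + q"
  let ?J = "juxt_word is (map garside_word is)"
  let ?C = "cross_word 0 ?n q" and ?G = "shift_word ?n (garside_word q)"
  let ?K = "shift_word q (cable_word (garside_word ?m) is)"
  have t: "braid_tuple is (map garside_word is)"
    by (simp add: list_all2_conv_all_nth)
  have J: "?J \<in> block_words 0 ?n"
    using juxt_word_bwords[OF t] by (simp add: bwords_block)
  have [simp]: "?G \<in> bwords ?N" "?K \<in> bwords ?N" "?J \<in> bwords ?N"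
    using bwords_shift[OF garside_word_bwords] block_words_bwords[OF J]
      bwords_shift[OF cable_word_bwords[of "garside_word ?m" "is"]] by simp_all
  have D: "cable_word (delta_word 1 (Suc ?m)) (is @ [q]) \<approx>\<^bsub>?N\<^esub> ?C"
    and p: "permute (delta_word 1 (Suc ?m)) (is @ [q]) = [q] @ is"
    using cable_delta[of "[]" "is" q ?N "[]"] by simp_all
  have K: "cable_word (shift_word 1 (garside_word ?m)) ([q] @ is) = ?K"
    using cable_word_right[of "garside_word ?m" "is" "[q]"] by simp
  have "comp_word (is @ [q]) (garside_word (length (is @ [q]))) (map garside_word (is @ [q]))
      \<approx>\<^bsub>?N\<^esub> (?J @ ?G) @ ?C @ ?K"
    using braid_eq_within[OF D, of "?J @ ?G" ?K] p K
    by (simp add: comp_word_def juxt_word_append garside_word_Suc cable_word_append)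
  \<comment> \<open>The braids of the first cables and that of the last one occupy disjoint strands.\<close>
  also have "\<dots> \<approx>\<^bsub>?N\<^esub> (?G @ ?J) @ ?C @ ?K"
    by (intro braid_eq_append braid_eq_refl
        disjoint_blocks_commute[OF J block_words_shift[OF garside_word_bwords]]) simp_all
  also have "\<dots> \<approx>\<^bsub>?N\<^esub> ?G @ (?C @ shift_word q ?J) @ ?K"
    using braid_eq_within[OF word_slide_cross[of ?J 0 ?n q ?N], of ?G ?K] J by simp
  \<comment> \<open>Having slid through, they compose with the cabled smaller Garside element.\<close>
  also have "\<dots> = (?G @ ?C) @ shift_word q (comp_word is (garside_word ?m) (map garside_word is))"
    by (simp add: comp_word_def)
  also have "\<dots> \<approx>\<^bsub>?N\<^esub> (?G @ ?C) @ shift_word q (garside_word ?n)"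
    by (intro braid_eq_append braid_eq_refl braid_eq_shift[OF snoc.IH]) simp_all
  also have "\<dots> \<approx>\<^bsub>?N\<^esub> garside_word ?N"
    using braid_eq_sym[OF garside_word_add] by simp
  finally show ?case by simp
qed

lemma braid_comp_garside:
  "braid_comp is (garside (length is)) (map garside is) = garside (sum_list is)"
proof -
  have t: "braid_tuple is (map garside_word is)"
    by (simp add: list_all2_conv_all_nth)
  have "map garside is = map2 braid_class is (map garside_word is)"
    by (rule nth_equalityI) (simp_all add: garside_def)
  then show ?thesis
    using braid_comp_class[OF garside_word_bwords t] braid_class_eqI[OF comp_word_garside]
    by (simp add: garside_def)
qed

section \<open>The suboperad of Garside elements\<close>

lemma op_args_mono: "op_args S is ys \<Longrightarrow> (\<And>n. S n \<subseteq> T n) \<Longrightarrow> op_args T is ys"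
  unfolding op_args_def by (erule list_all2_mono) auto

lemma ns_operad_suboperad:
  assumes "suboperad S P"
  shows "ns_operad (P\<lparr>ops := S\<rparr>)"
proof -
  interpret ns_operad P using assms by (simp add: suboperad_def)
  have S: "\<And>n. S n \<subseteq> ops P n" using assms by (simp add: suboperad_def)
  note mono = op_args_mono[OF _ S]
  have mono2: "list_all2 (op_args S) jss zss \<Longrightarrow> list_all2 (op_args (ops P)) jss zss" for jss zss
    by (erule list_all2_mono) (rule mono)
  show ?thesis
  proof
    show "op_unit (P\<lparr>ops := S\<rparr>) \<in> ops (P\<lparr>ops := S\<rparr>) 1"
      using assms by (simp add: suboperad_def)
    show "op_comp (P\<lparr>ops := S\<rparr>) is x ys \<in> ops (P\<lparr>ops := S\<rparr>) (sum_list is)"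
      if "x \<in> ops (P\<lparr>ops := S\<rparr>) (length is)" "op_args (ops (P\<lparr>ops := S\<rparr>)) is ys" for x "is" ys
      using assms that by (simp add: suboperad_def)
  qed (use S in \<open>simp_all add: unit_left unit_right[simplified] assoc mono mono2 subset_iff\<close>)
qed

lemma op_args_garside_family:
  "op_args garside_family is ys \<longleftrightarrow> ys = map garside is \<and> (\<forall>i\<in>set is. 0 < i)"
  by (auto simp: op_args_def garside_family_def list_all2_conv_all_nth all_set_conv_all_nth
      split: if_splits intro!: nth_equalityI)

lemma suboperad_garside_family: "suboperad garside_family braid_operad"
  unfolding suboperad_def
proof (intro conjI allI impI ns_operad_braid_operad)
  show "garside_family n \<subseteq> ops braid_operad n" for n
    by (simp add: garside_family_def ops_braid_operad garside_def)
  show "op_unit braid_operad \<in> garside_family 1"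
    by (simp add: garside_family_def op_unit_braid_operad garside_def garside_word_def)
  fix "is" x ys
  assume *: "x \<in> garside_family (length is) \<and> op_args garside_family is ys"
  then have "is \<noteq> []" "\<forall>i\<in>set is. 0 < i"
    by (auto simp: garside_family_def op_args_garside_family)
  then have "sum_list is \<noteq> 0" by (cases "is") auto
  with * show "op_comp braid_operad is x ys \<in> garside_family (sum_list is)"
    by (auto simp: garside_family_def op_args_garside_family op_comp_braid_operad
        braid_comp_garside split: if_splits)
qed

lemma ns_operad_assoc_operad: "ns_operad assoc_operad"
proof
  fix x "is" ys
  assume "x \<in> ops assoc_operad (length is)" and "op_args (ops assoc_operad) is ys"
  then show "op_comp assoc_operad is x ys \<in> ops assoc_operad (sum_list is)"
    by (cases "is") (auto simp: assoc_operad_def op_args_def list_all2_Cons1 split: if_splits)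
qed (simp_all add: assoc_operad_def)

theorem theorem3p6:
  shows "suboperad garside_family braid_operad
    \<and> isomorphic_operads (braid_operad\<lparr>ops := garside_family\<rparr>) assoc_operad
    \<and> (\<forall>is :: nat list. length is \<ge> 1 \<and> (\<forall>i\<in>set is. i \<ge> 1) \<longrightarrow>
        op_comp braid_operad is (garside (length is)) (map garside is) = garside (sum_list is))"
proof (intro conjI)
  show "suboperad garside_family braid_operad" by (rule suboperad_garside_family)
  have "operad_iso (braid_operad\<lparr>ops := garside_family\<rparr>) assoc_operad (\<lambda>_ _. ())"
    by (simp add: operad_iso_def assoc_operad_def garside_family_def bij_betw_def)
  then show "isomorphic_operads (braid_operad\<lparr>ops := garside_family\<rparr>) assoc_operad"
    unfolding isomorphic_operads_def
    using ns_operad_suboperad[OF suboperad_garside_family] ns_operad_assoc_operad by blast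
  show "\<forall>is :: nat list. length is \<ge> 1 \<and> (\<forall>i\<in>set is. i \<ge> 1) \<longrightarrow>
      op_comp braid_operad is (garside (length is)) (map garside is) = garside (sum_list is)"
    by (simp add: op_comp_braid_operad braid_comp_garside)
qed

end
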